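(* Let $h(x)=\mathbb E_\xi[\mathbf H(x,\xi)]$ for $x\in X$, and let $$\tilde h_\mu(x)=\mathbb E_{v,\xi}[\mathbf H(x+\mu v,\xi)],$$ where the auxiliary random vector $v\in\mathbb R^d$ follows the uniform density on the closed unit ball $B(0,1)$. Assume that $$\mathbb E_\xi\left[\|\partial\mathbf H(x,\xi)\|^2\right]\le L_0^2\quad\text{for any }x\in\operatorname{int}(X+B(0,\mu)).$$ Then: (i) $\tilde h_\mu$ is a smoothing function of $h$ with parameters $(\kappa,K,\mathcal L_h)=\left(\dfrac{L_0^2+1}{2},\,0,\,L_0\sqrt d\right)$. (ii) The unbiasedness and bounded-variance condition holds for the stochastic gradient $\nabla\tilde{\mathbf\Psi}_\mu(x,\zeta)$ with $\zeta=(\xi^T,v^T)^T$ and $\sigma^2=L_0^2$.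
   Context: **Setting.** $X\subseteq\mathbb R^d$ is closed and convex; $\xi$ is a random vector with support $\Xi$, independent of $v$; $\mathbf H(\cdot,\xi)$ are closed proper convex functions; $h$ is finite-valued and continuous on $X$; $f:X\to\mathbb R$ is convex with Lipschitz gradient. $\|\cdot\|$ is the Euclidean norm, $\partial\mathbf H(x,\xi)$ is the convex subdifferential of $\mathbf H(\cdot,\xi)$ at $x$ and $\|\partial\mathbf H(x,\xi)\|=\sup\{\|g\|:g\in\partial\mathbf H(x,\xi)\}$. $B(0,r)$ is the closed ball of radius $r$ centered at $0$. $\bar\mu>0$ is arbitrary, and the assumption in the claim is for every $\mu\in(0,\bar\mu]$. **Smoothing function.** For convex $c:X\to\mathbb R$, a function $\tilde c:X\times(0,\bar\mu]\to\mathbb R$ (write $\tilde c_\mu=\tilde c(\cdot,\mu)$) is a smoothing function of $c$ with parameters $(\kappa,K,\mathcal L_c)$ if for every $\mu\in(0,\bar\mu]$, $\tilde c_\mu$ is continuously differentiable on $X$ and: (a) $\lim_{z\to x,\mu\downarrow0}\tilde c(z,\mu)=c(x)$ for all $x\in X$; (b) $\tilde c_\mu$ is convex on $X$; (c) $|\tilde c(x,\mu_2)-\tilde c(x,\mu_1)|\le\kappa|\mu_1-\mu_2|$ for all $x\in X$, $\mu_1,\mu_2\in(0,\bar\mu]$, with constant $\kappa>0$; (d) $\nabla\tilde c_\mu$ is Lipschitz on $X$ with constant $K+\mathcal L_c/\mu$, where $K$ and $\mathcal L_c>0$ do not depend on $\mu$. **Stochastic gradient.** $\tilde\psi_\mu=f+\tilde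 h_\mu$, and $\nabla\tilde{\mathbf\Psi}_\mu(x,\zeta)=\nabla f(x)+g$ with $g\in\partial\mathbf H(x+\mu v,\xi)$ a (measurably selected) subgradient. **Unbiasedness and bounded-variance condition** (with constant $\sigma^2$ independent of $\mu$): for every $x\in X$ and $\mu\in(0,\bar\mu]$, $\mathbb E_\zeta[\nabla\tilde{\mathbf\Psi}_\mu(x,\zeta)]=\nabla\tilde\psi_\mu(x)$ and $\mathbb E_\zeta[\|\nabla\tilde{\mathbf\Psi}_\mu(x,\zeta)-\nabla\tilde\psi_\mu(x)\|^2]\le\sigma^2$. *)

theory Defs
  imports "HOL-Probability.Probability"
begin

section \<open>Extended-real expectations and supports\<close>

text \<open>
  The expectation of an extended-real random variable is the difference of the integrals of its
  positive and negative parts (\<^const>\<open>e2ennreal\<close> maps negative numbers to 0). Since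
  \<open>\<infinity> - \<infinity> = \<infinity>\<close> on \<^typ>\<open>ereal\<close>, it is finite iff both parts are integrable.
\<close>

definition ext_expectation :: "'w measure \<Rightarrow> ('w \<Rightarrow> ereal) \<Rightarrow> ereal" where
  "ext_expectation M Z =
     enn2ereal (\<integral>\<^sup>+ \<omega>. e2ennreal (Z \<omega>) \<partial>M) - enn2ereal (\<integral>\<^sup>+ \<omega>. e2ennreal (- Z \<omega>) \<partial>M)"

definition rv_support :: "'w measure \<Rightarrow> ('w \<Rightarrow> 'b::topological_space) \<Rightarrow> 'b set" where
  "rv_support M \<xi> = {s. \<forall>U. open U \<longrightarrow> s \<in> U \<longrightarrow> 0 < emeasure (distr M borel \<xi>) U}"

text \<open>
  \<^const>\<open>prob_space.indep_var\<close> forces both random variables to have the same value type; this is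
  independence of the generated sigma-algebras for two Borel random variables of different types.
\<close>

definition indep_rvs ::
  "'w measure \<Rightarrow> ('w \<Rightarrow> 'b::topological_space) \<Rightarrow> ('w \<Rightarrow> 'a::topological_space) \<Rightarrow> bool" where
  "indep_rvs M \<xi> v \<longleftrightarrow>
     prob_space.indep_set M (sets (vimage_algebra (space M) \<xi> borel))
                            (sets (vimage_algebra (space M) v borel))"

section \<open>Extended-real convex functions and subgradients\<close>

definition ereal_epigraph :: "('a \<Rightarrow> ereal) \<Rightarrow> ('a \<times> real) set" where
  "ereal_epigraph F = {(x, r). F x \<le> ereal r}"

definition closed_proper_convex :: "('a::euclidean_space \<Rightarrow> ereal) \<Rightarrow> bool" where
  "closed_proper_convex F \<longleftrightarrow>
     (\<forall>x. F x \<noteq> -\<infinity>) \<and> (\<exists>x. F x \<noteq> \<infinity>) \<and> convex (ereal_epigraph F) \<and> closed (ereal_epigraph F)"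

definition subdifferential :: "('a::euclidean_space \<Rightarrow> ereal) \<Rightarrow> 'a \<Rightarrow> 'a set" where
  "subdifferential F x = {g. \<forall>y. F x + ereal (g \<bullet> (y - x)) \<le> F y}"

text \<open>
  The supremum is taken in \<^typ>\<open>ereal\<close>, so it is \<open>-\<infinity>\<close> for the empty set, whose square is
  \<open>\<infinity>\<close>. Hence a finite second moment of the norm of a random subdifferential forces that
  subdifferential to be nonempty almost surely.
\<close>

definition set_norm :: "'a::real_normed_vector set \<Rightarrow> ereal" where
  "set_norm D = (SUP g\<in>D. ereal (norm g))"

lemma set_norm_empty_squared: "(set_norm {})\<^sup>2 = \<infinity>"
  by (simp add: set_norm_def power2_eq_square bot_ereal_def)

section \<open>Smoothing functions\<close>

text \<open>
  The functions under consideration are only meaningful on \<open>X\<close>, so derivatives are taken relative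
  to \<open>X\<close>. If \<open>X\<close> has empty interior a gradient field need not be unique, so it is passed
  explicitly: \<open>G\<close> is a field of gradients of \<open>F\<close> on \<open>X\<close>.
\<close>

definition gradient_on :: "'a::euclidean_space set \<Rightarrow> ('a \<Rightarrow> real) \<Rightarrow> ('a \<Rightarrow> 'a) \<Rightarrow> bool" where
  "gradient_on X F G \<longleftrightarrow> (\<forall>x\<in>X. (F has_derivative (\<lambda>y. G x \<bullet> y)) (at x within X))"

text \<open>
  \<open>gct x \<mu>\<close> is the gradient of \<open>ct \<sqdot> \<mu>\<close> at \<open>x\<close>. In the joint limit, \<open>(x, 0)\<close> is not in the
  restricting set, so the points \<open>(x, \<mu>)\<close> are not excluded.
\<close>

definition smoothing_function ::
  "'a::euclidean_space set \<Rightarrow> real \<Rightarrow> ('a \<Rightarrow> real) \<Rightarrow> ('a \<Rightarrow> real \<Rightarrow> real) \<Rightarrow>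
   ('a \<Rightarrow> real \<Rightarrow> 'a) \<Rightarrow> real \<Rightarrow> real \<Rightarrow> real \<Rightarrow> bool" where
  "smoothing_function X mubar c ct gct \<kappa> K L \<longleftrightarrow>
     convex_on X c \<and> 0 < \<kappa> \<and> 0 < L \<and>
     (\<forall>\<mu>\<in>{0<..mubar}. gradient_on X (\<lambda>x. ct x \<mu>) (\<lambda>x. gct x \<mu>) \<and>
                       continuous_on X (\<lambda>x. gct x \<mu>)) \<and>
     (\<forall>x\<in>X. ((\<lambda>(z, \<mu>). ct z \<mu>) \<longlongrightarrow> c x) (at (x, 0) within X \<times> {0<..mubar})) \<and>
     (\<forall>\<mu>\<in>{0<..mubar}. convex_on X (\<lambda>x. ct x \<mu>)) \<and>
     (\<forall>x\<in>X. \<forall>\<mu>1\<in>{0<..mubar}. \<forall>\<mu>2\<in>{0<..mubar}. \<bar>ct x \<mu>2 - ct x \<mu>1\<bar> \<le> \<kappa> * \<bar>\<mu>1 - \<mu>2\<bar>) \<and>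
     (\<forall>\<mu>\<in>{0<..mubar}. (K + L / \<mu>)-lipschitz_on X (\<lambda>x. gct x \<mu>))"

definition smoothed ::
  "'w measure \<Rightarrow> ('w \<Rightarrow> 'b) \<Rightarrow> ('w \<Rightarrow> 'a::euclidean_space) \<Rightarrow> ('a \<Rightarrow> 'b \<Rightarrow> ereal) \<Rightarrow> 'a \<Rightarrow> real \<Rightarrow> ereal"
where
  "smoothed M \<xi> v H x \<mu> = ext_expectation M (\<lambda>\<omega>. H (x + \<mu> *\<^sub>R v \<omega>) (\<xi> \<omega>))"

section \<open>Stochastic gradients\<close>

definition subgradient_selection ::
  "'w measure \<Rightarrow> ('w \<Rightarrow> 'b::euclidean_space) \<Rightarrow> ('w \<Rightarrow> 'a::euclidean_space) \<Rightarrow>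
   ('a \<Rightarrow> 'b \<Rightarrow> ereal) \<Rightarrow> 'a set \<Rightarrow> real \<Rightarrow> ('a \<Rightarrow> real \<Rightarrow> 'b \<times> 'a \<Rightarrow> 'a) \<Rightarrow> bool" where
  "subgradient_selection M \<xi> v H X mubar g \<longleftrightarrow>
     (\<forall>x\<in>X. \<forall>\<mu>\<in>{0<..mubar}.
        g x \<mu> \<in> borel_measurable (borel \<Otimes>\<^sub>M borel) \<and>
        (AE \<omega> in M. g x \<mu> (\<xi> \<omega>, v \<omega>) \<in> subdifferential (\<lambda>y. H y (\<xi> \<omega>)) (x + \<mu> *\<^sub>R v \<omega>)))"

text \<open>
  \<open>G x \<mu> (\<zeta> \<omega>)\<close> is the stochastic gradient and \<open>gpsi x \<mu>\<close> the gradient of \<open>psi \<sqdot> \<mu>\<close> at \<open>x\<close>.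
  Integrability is required because the Bochner integral of a non-integrable function is 0.
\<close>

definition unbiased_bounded_variance ::
  "'w measure \<Rightarrow> ('w \<Rightarrow> 'z) \<Rightarrow> 'a::euclidean_space set \<Rightarrow> real \<Rightarrow> ('a \<Rightarrow> real \<Rightarrow> real) \<Rightarrow>
   ('a \<Rightarrow> real \<Rightarrow> 'a) \<Rightarrow> ('a \<Rightarrow> real \<Rightarrow> 'z \<Rightarrow> 'a) \<Rightarrow> real \<Rightarrow> bool" where
  "unbiased_bounded_variance M \<zeta> X mubar psi gpsi G \<sigma>2 \<longleftrightarrow>
     (\<forall>\<mu>\<in>{0<..mubar}. gradient_on X (\<lambda>x. psi x \<mu>) (\<lambda>x. gpsi x \<mu>)) \<and>
     (\<forall>x\<in>X. \<forall>\<mu>\<in>{0<..mubar}.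
        integrable M (\<lambda>\<omega>. G x \<mu> (\<zeta> \<omega>)) \<and>
        (\<integral>\<omega>. G x \<mu> (\<zeta> \<omega>) \<partial>M) = gpsi x \<mu> \<and>
        integrable M (\<lambda>\<omega>. (norm (G x \<mu> (\<zeta> \<omega>) - gpsi x \<mu>))\<^sup>2) \<and>
        (\<integral>\<omega>. (norm (G x \<mu> (\<zeta> \<omega>) - gpsi x \<mu>))\<^sup>2 \<partial>M) \<le> \<sigma>2)"

end

theory Submission
  imports Defs
begin

text \<open>
  Write \<open>U\<close> for the interior of \<open>X + cball 0 mubar\<close>; it is open and convex, contains \<open>X\<close>, and for
  \<open>x \<in> X\<close> almost every perturbed point \<open>x + \<mu> v\<close> lies in it. The proof reduces the claim to one about a
  single deterministic convex function.

  \<^bold>\<open>Reduction.\<close> If \<open>x, y \<in> U\<close>, a subgradient of \<open>H(\<cdot>, \<xi>)\<close> at \<open>y\<close> bounds the positive part of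
  \<open>H(y, \<xi>) - H(x, \<xi>)\<close> by the norm of the subdifferential at \<open>y\<close> times \<open>norm (y - x)\<close>. Taking
  second moments makes \<open>E H(y, \<xi>)\<close> finite and \<open>L0\<close>-Lipschitz on \<open>U\<close>, and it inherits convexity
  (\<open>increment_second_moment\<close>, \<open>mean_H_lipschitz\<close>, \<open>mean_H_convex\<close>). It extends to a convex
  \<open>L0\<close>-Lipschitz function \<open>F\<close> on the whole space (\<open>convex_lipschitz_extension\<close>), and Fubini turns the
  smoothed function into the average of \<open>F\<close> over the ball of radius \<open>\<mu>\<close> around \<open>x\<close>
  (\<open>smoothed_eq_ball_average\<close>). Convexity, the joint limit and the Lipschitz dependence on \<open>\<mu>\<close> are then
  immediate; the constant \<open>(L0\<^sup>2 + 1) / 2\<close> merely dominates \<open>L0\<close>.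

  \<^bold>\<open>Smoothness.\<close> Rescale to \<open>\<mu> = 1\<close>. After a change of variables, the second difference in direction \<open>w\<close> of an
  integral of \<open>F\<close> over a unit ball is the integral of a first difference of \<open>F\<close> against a first difference of the
  indicator of the ball. So it is at most \<open>L0\<close> times \<open>norm w\<close> times the L1 distance between the indicators of the
  ball and of its translate by \<open>w\<close>, and that distance is at most \<open>sqrt d * norm w\<close> times the volume of the ball (\<open>shift_variation_unit_ball\<close>). The factor
  \<open>sqrt d\<close> arises as \<open>d / sqrt d\<close>: a thin shell of width \<open>\<epsilon>\<close> below the unit sphere has volume about
  \<open>d \<epsilon>\<close> times that of the ball, and on it the component of \<open>z / norm z\<close> in a fixed direction has mean
  square \<open>1 / d\<close> by symmetry, hence mean absolute value at most \<open>1 / sqrt d\<close>. A convex function whose second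
  differences are bounded by \<open>C (norm w)\<^sup>2\<close> is differentiable with \<open>C\<close>-Lipschitz gradient
  (\<open>convex_second_difference_imp_smooth\<close>). Working with second differences
  avoids the almost everywhere differentiability of convex functions.

  \<^bold>\<open>Stochastic gradients.\<close> For a measurable selection \<open>g\<close> of subgradients, integrating the subgradient
  inequality shows that \<open>E g\<close> is a subgradient of the ball average at \<open>x\<close>, so it equals the gradient
  there. For almost every fixed perturbation \<open>g\<close> is dominated by the norm of the subdifferential, which
  gives \<open>E (norm g)\<^sup>2 \<le> L0\<^sup>2\<close>, and the variance is at most the second moment (\<open>selection_moments\<close>).
\<close>

section \<open>Symmetries of Lebesgue measure and radial second moments\<close>

lemma lborel_integral_translate:
  fixes f :: "'a::euclidean_space \<Rightarrow> 'b::{banach, second_countable_topology}"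
  assumes [measurable]: "f \<in> borel_measurable borel"
  shows "(\<integral>z. f (z + c) \<partial>lborel) = (\<integral>z. f z \<partial>lborel)"
proof -
  have "(\<integral>z. f z \<partial>lborel) = (\<integral>z. f z \<partial>distr lborel borel ((+) c))"
    by (simp add: lborel_distr_plus)
  also have "\<dots> = (\<integral>z. f (c + z) \<partial>lborel)"
    by (subst integral_distr) auto
  finally show ?thesis by (simp add: add.commute)
qed

lemma lborel_integrable_translate:
  fixes f :: "'a::euclidean_space \<Rightarrow> 'b::{banach, second_countable_topology}"
  assumes "integrable lborel f"
  shows "integrable lborel (\<lambda>z. f (z + c))"
proof -
  have [measurable]: "f \<in> borel_measurable borel"
    using assms by auto
  have "integrable (distr lborel borel ((+) c)) f"
    using assms by (simp add: lborel_distr_plus)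
  then have "integrable lborel (\<lambda>z. f (c + z))"
    by (subst (asm) integrable_distr_eq) auto
  then show ?thesis by (simp add: add.commute)
qed

text \<open>
  Rotation by a right angle in the plane of two coordinate axes. Its sign change kills mixed moments and
  its exchange of coordinates equates pure ones, so this one family supplies all the rotational symmetry
  that the second moments of a radial density require.
\<close>

definition quarter_turn :: "'a::euclidean_space \<Rightarrow> 'a \<Rightarrow> 'a \<Rightarrow> 'a" where
  "quarter_turn i j z = z + (z \<bullet> j - z \<bullet> i) *\<^sub>R i - (z \<bullet> i + z \<bullet> j) *\<^sub>R j"

lemma quarter_turn_inner:
  assumes "i \<in> Basis" "j \<in> Basis" "i \<noteq> j" "b \<in> Basis"
  shows "quarter_turn i j z \<bullet> b = (if b = i then z \<bullet> j else if b = j then - (z \<bullet> i) else z \<bullet> b)"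
  using assms by (auto simp: quarter_turn_def inner_simps inner_Basis)

lemma norm_quarter_turn:
  assumes "i \<in> Basis" "j \<in> Basis" "i \<noteq> j"
  shows "norm (quarter_turn i j z) = norm z"
proof -
  have "quarter_turn i j z \<bullet> quarter_turn i j z = z \<bullet> z"
    using assms by (simp add: quarter_turn_def inner_simps inner_Basis inner_commute algebra_simps)
  then show ?thesis by (simp add: norm_eq_sqrt_inner)
qed

lemma quarter_turn_measurable [measurable]: "quarter_turn i j \<in> borel_measurable borel"
  unfolding quarter_turn_def[abs_def] by measurable

text \<open>
  The preimage of a box is a box whose side lengths are those of the original one, permuted; boxes
  determine Lebesgue measure.
\<close>

lemma distr_lborel_quarter_turn:
  assumes ij: "i \<in> Basis" "j \<in> Basis" "i \<noteq> j"
  shows "distr lborel borel (quarter_turn i j) = (lborel :: 'a::euclidean_space measure)"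
proof (rule lborel_eqI[symmetric])
  fix l u :: 'a
  assume lu: "\<And>b. b \<in> Basis \<Longrightarrow> l \<bullet> b \<le> u \<bullet> b"
  define l' where "l' = (\<Sum>b\<in>Basis. (if b = i then - (u \<bullet> j) else if b = j then l \<bullet> i else l \<bullet> b) *\<^sub>R b)"
  define u' where "u' = (\<Sum>b\<in>Basis. (if b = i then - (l \<bullet> j) else if b = j then u \<bullet> i else u \<bullet> b) *\<^sub>R b)"
  have l': "l' \<bullet> b = (if b = i then - (u \<bullet> j) else if b = j then l \<bullet> i else l \<bullet> b)" if "b \<in> Basis" for b
    using that unfolding l'_def by (simp add: inner_sum_left_Basis)
  have u': "u' \<bullet> b = (if b = i then - (l \<bullet> j) else if b = j then u \<bullet> i else u \<bullet> b)" if "b \<in> Basis" for b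
    using that unfolding u'_def by (simp add: inner_sum_left_Basis)
  have "z \<in> quarter_turn i j -` box l u \<longleftrightarrow> z \<in> box l' u'" for z
  proof -
    have "z \<in> quarter_turn i j -` box l u \<longleftrightarrow>
      (\<forall>b\<in>Basis. l \<bullet> b < (if b = i then z \<bullet> j else if b = j then - (z \<bullet> i) else z \<bullet> b) \<and>
                 (if b = i then z \<bullet> j else if b = j then - (z \<bullet> i) else z \<bullet> b) < u \<bullet> b)"
      using ij by (simp add: mem_box quarter_turn_inner)
    also have "\<dots> \<longleftrightarrow> (\<forall>b\<in>Basis. l' \<bullet> b < z \<bullet> b \<and> z \<bullet> b < u' \<bullet> b)"
    proof (intro iffI ballI)
      fix b :: 'a assume *: "\<forall>b\<in>Basis. l \<bullet> b < (if b = i then z \<bullet> j else if b = j then - (z \<bullet> i) else z \<bullet> b) \<and>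
                 (if b = i then z \<bullet> j else if b = j then - (z \<bullet> i) else z \<bullet> b) < u \<bullet> b"
        and b: "b \<in> Basis"
      show "l' \<bullet> b < z \<bullet> b \<and> z \<bullet> b < u' \<bullet> b"
        using bspec[OF *, of i] bspec[OF *, of j] bspec[OF *, of b] b ij by (auto simp: l' u')
    next
      fix b :: 'a assume *: "\<forall>b\<in>Basis. l' \<bullet> b < z \<bullet> b \<and> z \<bullet> b < u' \<bullet> b" and b: "b \<in> Basis"
      show "l \<bullet> b < (if b = i then z \<bullet> j else if b = j then - (z \<bullet> i) else z \<bullet> b) \<and>
                 (if b = i then z \<bullet> j else if b = j then - (z \<bullet> i) else z \<bullet> b) < u \<bullet> b"
        using bspec[OF *, of i] bspec[OF *, of j] bspec[OF *, of b] b ij by (auto simp: l' u')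
    qed
    also have "\<dots> \<longleftrightarrow> z \<in> box l' u'" by (simp add: mem_box)
    finally show ?thesis .
  qed
  then have eq: "quarter_turn i j -` box l u = box l' u'" by blast
  have le: "l' \<bullet> b \<le> u' \<bullet> b" if "b \<in> Basis" for b
    using lu ij that by (simp add: l' u')
  have "emeasure (distr lborel borel (quarter_turn i j)) (box l u) = emeasure lborel (box l' u')"
    by (subst emeasure_distr) (auto simp: eq)
  also have "\<dots> = ennreal (\<Prod>b\<in>Basis. (u' - l') \<bullet> b)"
    using le by (simp add: emeasure_lborel_box_eq)
  also have "(\<Prod>b\<in>Basis. (u' - l') \<bullet> b) = (\<Prod>b\<in>Basis. (u - l) \<bullet> b)"
  proof -
    have split: "(\<Prod>b\<in>Basis. g b) = g i * g j * (\<Prod>b\<in>Basis - {i, j}. g b)" for g :: "'a \<Rightarrow> real"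
      using prod.subset_diff[of "{i, j}" Basis g] ij by (simp add: mult.commute)
    have "(\<Prod>b\<in>Basis - {i, j}. (u' - l') \<bullet> b) = (\<Prod>b\<in>Basis - {i, j}. (u - l) \<bullet> b)"
      by (intro prod.cong) (auto simp: inner_simps l' u')
    then show ?thesis
      using ij by (subst (1 2) split) (simp add: inner_simps l' u' algebra_simps)
  qed
  finally show "emeasure (distr lborel borel (quarter_turn i j)) (box l u) = (\<Prod>b\<in>Basis. (u - l) \<bullet> b)"
    using lu by (simp add: prod_ennreal inner_simps)
qed simp

lemma lborel_integral_quarter_turn:
  fixes f :: "'a::euclidean_space \<Rightarrow> real"
  assumes "i \<in> Basis" "j \<in> Basis" "i \<noteq> j" and [measurable]: "f \<in> borel_measurable borel"
  shows "(\<integral>z. f (quarter_turn i j z) \<partial>lborel) = (\<integral>z. f z \<partial>lborel)"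
proof -
  have "(\<integral>z. f z \<partial>distr lborel borel (quarter_turn i j)) = (\<integral>z. f (quarter_turn i j z) \<partial>lborel)"
    by (subst integral_distr) auto
  then show ?thesis by (simp add: distr_lborel_quarter_turn[OF assms(1-3)])
qed

text \<open>
  Expand \<open>(z \<bullet> w)\<^sup>2\<close> in coordinates: by quarter turns the mixed moments vanish and the pure ones agree, so each
  is the fraction \<open>1 / d\<close> of the trace, which is the integral of \<open>\<phi> (norm z) * (norm z)\<^sup>2\<close>.
\<close>

lemma radial_second_moment:
  fixes \<phi> :: "real \<Rightarrow> real" and w :: "'a::euclidean_space"
  assumes [measurable]: "\<phi> \<in> borel_measurable borel"
    and int: "integrable lborel (\<lambda>z::'a. \<phi> (norm z) * (norm z)\<^sup>2)"
  shows "integrable lborel (\<lambda>z. \<phi> (norm z) * (z \<bullet> w)\<^sup>2)"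
    and "(\<integral>z. \<phi> (norm z) * (z \<bullet> w)\<^sup>2 \<partial>lborel) =
      (norm w)\<^sup>2 / DIM('a) * (\<integral>z. \<phi> (norm (z::'a)) * (norm z)\<^sup>2 \<partial>lborel)"
proof -
  define I where "I i j = (\<integral>z. \<phi> (norm (z::'a)) * ((z \<bullet> i) * (z \<bullet> j)) \<partial>lborel)" for i j :: 'a
  have intb: "integrable lborel (\<lambda>z::'a. \<phi> (norm z) * ((z \<bullet> i) * (z \<bullet> j)))"
    if "i \<in> Basis" "j \<in> Basis" for i j :: 'a
  proof (rule Bochner_Integration.integrable_bound[OF int])
    show "AE z in lborel. norm (\<phi> (norm z) * ((z \<bullet> i) * (z \<bullet> j))) \<le> norm (\<phi> (norm z) * (norm z)\<^sup>2)"
      using that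
      by (auto simp: abs_mult power2_eq_square intro!: mult_left_mono mult_mono Basis_le_norm)
  qed measurable
  have diag: "I i i = I j j" if "i \<in> Basis" "j \<in> Basis" for i j
  proof (cases "i = j")
    case False
    show ?thesis
      using lborel_integral_quarter_turn[of i j "\<lambda>z. \<phi> (norm z) * ((z \<bullet> i) * (z \<bullet> i))"] that False
      unfolding I_def by (simp add: norm_quarter_turn quarter_turn_inner)
  qed simp
  have off: "I i j = 0" if "i \<in> Basis" "j \<in> Basis" "i \<noteq> j" for i j
    using lborel_integral_quarter_turn[of i j "\<lambda>z. \<phi> (norm z) * ((z \<bullet> i) * (z \<bullet> j))"] that
    unfolding I_def by (simp add: norm_quarter_turn quarter_turn_inner mult.commute)
  obtain i0 :: 'a where i0: "i0 \<in> Basis" using nonempty_Basis by blast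
  have sq: "(z \<bullet> y)\<^sup>2 = (\<Sum>i\<in>Basis. \<Sum>j\<in>Basis. (y \<bullet> i) * (y \<bullet> j) * ((z \<bullet> i) * (z \<bullet> j)))" for y z :: 'a
    unfolding power2_eq_square euclidean_inner[of z y] sum_product by (simp add: ac_simps)
  have eq: "\<phi> (norm z) * (z \<bullet> y)\<^sup>2 =
     (\<Sum>i\<in>Basis. \<Sum>j\<in>Basis. (y \<bullet> i) * (y \<bullet> j) * (\<phi> (norm z) * ((z \<bullet> i) * (z \<bullet> j))))" for y z :: 'a
    unfolding sq sum_distrib_left by (simp add: ac_simps)
  show "integrable lborel (\<lambda>z. \<phi> (norm z) * (z \<bullet> w)\<^sup>2)"
    unfolding eq using intb by (intro Bochner_Integration.integrable_sum integrable_mult_right) auto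
  have "(\<integral>z. \<phi> (norm z) * (z \<bullet> w)\<^sup>2 \<partial>lborel) =
      (\<Sum>i\<in>Basis. \<Sum>j\<in>Basis. (w \<bullet> i) * (w \<bullet> j) * I i j)"
  proof -
    have "(\<integral>z. (\<Sum>j\<in>Basis. (w \<bullet> i) * (w \<bullet> j) * (\<phi> (norm z) * ((z \<bullet> i) * (z \<bullet> j)))) \<partial>lborel) =
      (\<Sum>j\<in>Basis. (w \<bullet> i) * (w \<bullet> j) * I i j)" if "i \<in> Basis" for i
      unfolding I_def using intb that by (subst Bochner_Integration.integral_sum) auto
    then show ?thesis
      unfolding eq using intb
      by (subst Bochner_Integration.integral_sum)
        (auto intro!: Bochner_Integration.integrable_sum integrable_mult_right sum.cong)
  qed
  also have "\<dots> = (\<Sum>i\<in>Basis. (w \<bullet> i) * (w \<bullet> i) * I i0 i0)"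
  proof (intro sum.cong refl)
    fix i :: 'a assume i: "i \<in> Basis"
    have "(\<Sum>j\<in>Basis. (w \<bullet> i) * (w \<bullet> j) * I i j) = (\<Sum>j\<in>Basis. if j = i then (w \<bullet> i) * (w \<bullet> i) * I i0 i0 else 0)"
    proof (intro sum.cong refl)
      fix j :: 'a assume "j \<in> Basis"
      then show "(w \<bullet> i) * (w \<bullet> j) * I i j = (if j = i then (w \<bullet> i) * (w \<bullet> i) * I i0 i0 else 0)"
        using off[OF i, of j] diag[OF i i0] by (cases "j = i") simp_all
    qed
    then show "(\<Sum>j\<in>Basis. (w \<bullet> i) * (w \<bullet> j) * I i j) = (w \<bullet> i) * (w \<bullet> i) * I i0 i0"
      using i by simp
  qed
  also have "\<dots> = (norm w)\<^sup>2 * I i0 i0"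
    unfolding power2_norm_eq_inner euclidean_inner[of w w] sum_distrib_right ..
  finally have A: "(\<integral>z. \<phi> (norm z) * (z \<bullet> w)\<^sup>2 \<partial>lborel) = (norm w)\<^sup>2 * I i0 i0" .
  have "(\<integral>z. \<phi> (norm (z::'a)) * (norm z)\<^sup>2 \<partial>lborel) = (\<integral>z. (\<Sum>i\<in>Basis. \<phi> (norm (z::'a)) * ((z \<bullet> i) * (z \<bullet> i))) \<partial>lborel)"
    unfolding power2_norm_eq_inner by (subst euclidean_inner) (simp add: sum_distrib_left)
  also have "\<dots> = (\<Sum>i\<in>Basis. I i i)"
    unfolding I_def using intb by (subst Bochner_Integration.integral_sum) auto
  also have "\<dots> = (\<Sum>i\<in>(Basis::'a set). I i0 i0)"
    using diag[OF _ i0] by (intro sum.cong refl)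
  also have "\<dots> = DIM('a) * I i0 i0" by simp
  finally show "(\<integral>z. \<phi> (norm z) * (z \<bullet> w)\<^sup>2 \<partial>lborel) =
      (norm w)\<^sup>2 / DIM('a) * (\<integral>z. \<phi> (norm (z::'a)) * (norm z)\<^sup>2 \<partial>lborel)"
    using A by simp
qed

section \<open>The L1 modulus of translation of the unit ball\<close>

lemmas emeasure_bounded_less_top = emeasure_bounded_finite[unfolded infinity_ennreal_def]

text \<open>
  The L1 modulus of translation. It is subadditive in the shift, so a bound to first order at \<open>0\<close> is
  already a global linear bound.
\<close>

definition shift_variation :: "('a::euclidean_space \<Rightarrow> real) \<Rightarrow> 'a \<Rightarrow> real" where
  "shift_variation k w = (\<integral>z. \<bar>k (z + w) - k z\<bar> \<partial>lborel)"

lemma shift_variation_integrable: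
  fixes k :: "'a::euclidean_space \<Rightarrow> real"
  assumes "integrable lborel k"
  shows "integrable lborel (\<lambda>z. \<bar>k (z + w) - k z\<bar>)"
  using lborel_integrable_translate[OF assms, of w] assms by auto

text \<open>
  Telescope along \<open>0, w, 2 w, \<dots>, n w\<close>; every step has the same modulus by translation invariance.
\<close>

lemma shift_variation_multiple:
  fixes k :: "'a::euclidean_space \<Rightarrow> real"
  assumes k: "integrable lborel k"
  shows "shift_variation k (real n *\<^sub>R w) \<le> real n * shift_variation k w"
proof (induction n)
  case 0
  then show ?case by (simp add: shift_variation_def)
next
  case (Suc n)
  have [measurable]: "k \<in> borel_measurable borel" using k by auto
  have 1: "integrable lborel (\<lambda>z. \<bar>k (z + real n *\<^sub>R w + w) - k (z + real n *\<^sub>R w)\<bar>)"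
    using lborel_integrable_translate[OF shift_variation_integrable[OF k, of w], of "real n *\<^sub>R w"] .
  have "shift_variation k (real (Suc n) *\<^sub>R w) =
      (\<integral>z. \<bar>k (z + real (Suc n) *\<^sub>R w) - k z\<bar> \<partial>lborel)"
    by (simp add: shift_variation_def)
  also have "\<dots> \<le> (\<integral>z. \<bar>k (z + real n *\<^sub>R w + w) - k (z + real n *\<^sub>R w)\<bar> + \<bar>k (z + real n *\<^sub>R w) - k z\<bar> \<partial>lborel)"
  proof (intro integral_mono Bochner_Integration.integrable_add 1 shift_variation_integrable[OF k])
    show "\<bar>k (z + real (Suc n) *\<^sub>R w) - k z\<bar> \<le>
        \<bar>k (z + real n *\<^sub>R w + w) - k (z + real n *\<^sub>R w)\<bar> + \<bar>k (z + real n *\<^sub>R w) - k z\<bar>" for z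
      by (simp add: algebra_simps)
  qed
  also have "\<dots> = shift_variation k w + shift_variation k (real n *\<^sub>R w)"
    using lborel_integral_translate[of "\<lambda>z. \<bar>k (z + w) - k z\<bar>" "real n *\<^sub>R w"]
    by (subst Bochner_Integration.integral_add[OF 1 shift_variation_integrable[OF k]])
      (simp add: shift_variation_def)
  finally show ?case using Suc.IH by (simp add: algebra_simps)
qed

lemma shift_variation_perturb:
  fixes k l :: "'a::euclidean_space \<Rightarrow> real"
  assumes k: "integrable lborel k" and l: "integrable lborel l"
  shows "shift_variation k w \<le> shift_variation l w + 2 * (\<integral>z. \<bar>k z - l z\<bar> \<partial>lborel)"
proof -
  have [measurable]: "k \<in> borel_measurable borel" "l \<in> borel_measurable borel" using k l by auto
  have d: "integrable lborel (\<lambda>z. \<bar>k z - l z\<bar>)" using k l by auto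
  note d' = lborel_integrable_translate[OF d, of w]
  have "shift_variation k w \<le> (\<integral>z. \<bar>l (z + w) - l z\<bar> + (\<bar>k (z + w) - l (z + w)\<bar> + \<bar>k z - l z\<bar>) \<partial>lborel)"
    unfolding shift_variation_def using shift_variation_integrable[OF k] shift_variation_integrable[OF l] d d'
    by (intro integral_mono Bochner_Integration.integrable_add) auto
  also have "\<dots> = shift_variation l w + ((\<integral>z. \<bar>k (z + w) - l (z + w)\<bar> \<partial>lborel) + (\<integral>z. \<bar>k z - l z\<bar> \<partial>lborel))"
    unfolding shift_variation_def using shift_variation_integrable[OF l] d d'
    by (simp add: Bochner_Integration.integral_add Bochner_Integration.integrable_add)
  also have "(\<integral>z. \<bar>k (z + w) - l (z + w)\<bar> \<partial>lborel) = (\<integral>z. \<bar>k z - l z\<bar> \<partial>lborel)"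
    by (rule lborel_integral_translate) measurable
  finally show ?thesis by simp
qed

definition shell :: "real \<Rightarrow> real \<Rightarrow> 'a::euclidean_space set" where
  "shell r s = {z. r \<le> norm z \<and> norm z \<le> s}"

lemma shell_eq: "shell r s = cball 0 s - ball 0 r"
  by (auto simp: shell_def)

lemma shell_measurable [measurable]: "shell r s \<in> sets borel"
  by (simp add: shell_eq)

lemma measure_shell:
  assumes "0 \<le> r" "r \<le> s"
  shows "emeasure lborel (shell r s :: 'a::euclidean_space set) < \<infinity>"
    and "measure lborel (shell r s :: 'a set) = unit_ball_vol DIM('a) * (s ^ DIM('a) - r ^ DIM('a))"
proof -
  have "emeasure lborel (shell r s :: 'a set) \<le> emeasure lborel (cball (0::'a) s)"
    by (intro emeasure_mono) (auto simp: shell_eq)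
  then show "emeasure lborel (shell r s :: 'a set) < \<infinity>"
    using emeasure_bounded_finite[OF bounded_cball] by (rule order_le_less_trans)
  have "measure lborel (shell r s :: 'a set) = measure lborel (cball (0::'a) s) - measure lborel (ball (0::'a) r)"
    unfolding shell_eq using assms
    by (intro measure_Diff) (auto simp: emeasure_bounded_less_top less_imp_neq)
  then show "measure lborel (shell r s :: 'a set) = unit_ball_vol DIM('a) * (s ^ DIM('a) - r ^ DIM('a))"
    using assms by (simp add: content_cball content_ball algebra_simps)
qed

text \<open>
  Radial profile of a Lipschitz approximation of the indicator of the unit ball: \<open>1\<close> up to radius \<open>a\<close>, then
  linear down to \<open>0\<close> at radius \<open>1\<close>.
\<close>

definition cutoff :: "real \<Rightarrow> real \<Rightarrow> real" where
  "cutoff a r = max 0 (min 1 ((1 - r) / (1 - a)))"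

lemma cutoff_measurable [measurable]: "cutoff a \<in> borel_measurable borel"
  unfolding cutoff_def[abs_def] by measurable

lemma cutoff_lipschitz:
  assumes "a < 1"
  shows "\<bar>cutoff a r - cutoff a s\<bar> \<le> \<bar>r - s\<bar> / (1 - a)"
proof -
  have "\<bar>cutoff a r - cutoff a s\<bar> \<le> \<bar>(1 - r) / (1 - a) - (1 - s) / (1 - a)\<bar>"
    unfolding cutoff_def by linarith
  also have "\<dots> = \<bar>r - s\<bar> / (1 - a)"
    using assms by (simp add: diff_divide_distrib[symmetric] abs_minus_commute)
  finally show ?thesis .
qed

lemma cutoff_eq_1: "a < 1 \<Longrightarrow> r \<le> a \<Longrightarrow> cutoff a r = 1"
  by (auto simp: cutoff_def divide_simps)

lemma cutoff_eq_0: "a < 1 \<Longrightarrow> 1 \<le> r \<Longrightarrow> cutoff a r = 0"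
  by (auto simp: cutoff_def divide_simps)

lemma cutoff_bounds: "0 \<le> cutoff a r" "cutoff a r \<le> 1"
  by (auto simp: cutoff_def)

lemma cutoff_integrable:
  assumes "a < 1"
  shows "integrable lborel (\<lambda>z::'a::euclidean_space. cutoff a (norm z))"
proof (rule Bochner_Integration.integrable_bound)
  show "integrable lborel (indicator (cball (0::'a) 1) :: 'a \<Rightarrow> real)"
    by (intro integrable_real_indicator) (auto simp: emeasure_bounded_less_top)
  show "AE z in lborel. norm (cutoff a (norm (z::'a))) \<le> norm (indicator (cball (0::'a) 1) z :: real)"
    using assms cutoff_bounds[of a] by (auto simp: cutoff_eq_0 indicator_def)
qed measurable

text \<open>
  To first order in \<open>w\<close> the norm changes by \<open>z \<bullet> w / norm z\<close>; the last term bounds the second order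
  remainder from above, while convexity of the norm bounds it from below by \<open>0\<close>.
\<close>

lemma norm_shift_bound:
  fixes z w :: "'a::euclidean_space"
  assumes "z \<noteq> 0"
  shows "\<bar>norm (z + w) - norm z\<bar> \<le> \<bar>z \<bullet> w\<bar> / norm z + (norm w)\<^sup>2 / (2 * norm z)"
proof -
  define p q where "p = norm (z + w)" and "q = norm z"
  have q: "q > 0" using assms by (simp add: q_def)
  have e: "p\<^sup>2 = q\<^sup>2 + 2 * (z \<bullet> w) + (norm w)\<^sup>2"
    unfolding p_def q_def by (simp add: power2_norm_eq_inner inner_simps inner_commute)
  have up: "(p - q) * (2 * q) \<le> 2 * \<bar>z \<bullet> w\<bar> + (norm w)\<^sup>2"
    using zero_le_power2[of "p - q"] e by (auto simp: power2_eq_square algebra_simps)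
  have "z \<bullet> (z + w) \<le> q * p"
    unfolding p_def q_def using Cauchy_Schwarz_ineq2[of z "z + w"] by linarith
  then have "q\<^sup>2 + z \<bullet> w \<le> q * p"
    by (simp add: inner_simps q_def power2_norm_eq_inner)
  then have "(q - p) * (2 * q) \<le> 2 * \<bar>z \<bullet> w\<bar> + (norm w)\<^sup>2"
    using zero_le_power2[of "norm w"] abs_ge_minus_self[of "z \<bullet> w"]
    unfolding power2_eq_square left_diff_distrib
    by (simp only: mult.commute[of p] mult.commute[of q 2] mult.left_commute[of _ 2])
  with up have "\<bar>p - q\<bar> * (2 * q) \<le> 2 * \<bar>z \<bullet> w\<bar> + (norm w)\<^sup>2"
    by (cases "p \<ge> q") auto
  then have "\<bar>p - q\<bar> \<le> (2 * \<bar>z \<bullet> w\<bar> + (norm w)\<^sup>2) / (2 * q)"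
    using q by (simp add: pos_le_divide_eq)
  then show ?thesis
    using q by (simp add: p_def q_def add_divide_distrib)
qed

text \<open>
  The profile only changes on a shell, at rate at most \<open>1 / (1 - a)\<close> times the change of the norm, whose
  leading part is \<open>\<bar>z \<bullet> w\<bar> / norm z\<close>. The inequality between arithmetic and geometric means, weighted by \<open>sqrt d\<close>,
  replaces this absolute value by its square, which the radial second moment evaluates exactly. The weight is the
  one for which both halves contribute \<open>norm w / (2 * sqrt d)\<close>.
\<close>

lemma shift_variation_cutoff_local:
  fixes w :: "'a::euclidean_space"
  assumes a: "0 < a" "a < 1" and w: "w \<noteq> 0" "norm w < a"
  shows "shift_variation (\<lambda>z. cutoff a (norm z)) w \<le>
     unit_ball_vol DIM('a) * ((1 + norm w) ^ DIM('a) - (a - norm w) ^ DIM('a)) / (1 - a) *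
     (norm w / sqrt DIM('a) + (norm w)\<^sup>2 / (2 * (a - norm w)))"
proof -
  define \<delta> where "\<delta> = norm w"
  define D where "D = sqrt DIM('a)"
  have D: "D > 0" "D\<^sup>2 = DIM('a)" by (auto simp: D_def)
  have \<delta>: "0 < \<delta>" "\<delta> < a" using w by (auto simp: \<delta>_def)
  define S where "S = (shell (a - \<delta>) (1 + \<delta>) :: 'a set)"
  have S[measurable]: "S \<in> sets borel" unfolding S_def by measurable
  note mS = measure_shell[of "a - \<delta>" "1 + \<delta>", where 'a='a, folded S_def]
  have intS: "integrable lborel (indicator S :: 'a \<Rightarrow> real)"
    using mS \<delta> a by (intro integrable_real_indicator) auto
  \<comment> \<open>dividing by the squared radius makes the second moment that of the unit vector \<open>z / norm z\<close> on the shell\<close>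
  define \<phi> where "\<phi> r = (indicator {a - \<delta> .. 1 + \<delta>} r :: real) / r\<^sup>2" for r :: real
  have \<phi>m [measurable]: "\<phi> \<in> borel_measurable borel" unfolding \<phi>_def by measurable
  have \<phi>: "\<phi> (norm z) * (norm z)\<^sup>2 = indicator S z" for z :: 'a
    using \<delta> by (auto simp: \<phi>_def S_def shell_def indicator_def)
  have mom: "integrable lborel (\<lambda>z. \<phi> (norm z) * (z \<bullet> w)\<^sup>2)"
    "(\<integral>z. \<phi> (norm z) * (z \<bullet> w)\<^sup>2 \<partial>lborel) = \<delta>\<^sup>2 / DIM('a) * measure lborel S"
    using radial_second_moment[of \<phi> w] intS by (simp_all add: \<phi> \<delta>_def)
  define b where "b z = (D / (2 * \<delta>) * (\<phi> (norm z) * (z \<bullet> w)\<^sup>2)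
     + (\<delta> / (2 * D) + \<delta>\<^sup>2 / (2 * (a - \<delta>))) * indicator S z) / (1 - a)" for z :: 'a
  have pw: "\<bar>cutoff a (norm (z + w)) - cutoff a (norm z)\<bar> \<le> b z" for z
  proof (cases "z \<in> S")
    case False
    then consider "norm z < a - \<delta>" | "norm z > 1 + \<delta>"
      by (force simp: S_def shell_def)
    then have "cutoff a (norm (z + w)) = cutoff a (norm z)"
    proof cases
      case 1
      then show ?thesis
        using norm_triangle_ineq[of z w] a norm_ge_zero[of w] unfolding \<delta>_def
        by (subst (1 2) cutoff_eq_1) linarith+
    next
      case 2
      then show ?thesis
        using norm_diff_ineq[of z w] a norm_ge_zero[of w] unfolding \<delta>_def
        by (subst (1 2) cutoff_eq_0) linarith+
    qed
    moreover have "b z \<ge> 0"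
      using D \<delta> a by (auto simp: b_def \<phi>_def)
    ultimately show ?thesis by simp
  next
    case True
    then have nz: "norm z \<ge> a - \<delta>" "norm z > 0" and S1: "indicator S z = (1::real)"
      using \<delta> by (auto simp: S_def shell_def)
    define t where "t = \<bar>z \<bullet> w\<bar> / norm z"
    have t2: "\<phi> (norm z) * (z \<bullet> w)\<^sup>2 = t\<^sup>2"
      using True nz by (auto simp: \<phi>_def S_def shell_def t_def power_divide)
    have "0 \<le> (D * t - \<delta>)\<^sup>2" by simp
    then have "2 * D * \<delta> * t \<le> D\<^sup>2 * t\<^sup>2 + \<delta>\<^sup>2"
      by (simp add: power2_eq_square algebra_simps)
    then have amgm: "t \<le> D / (2 * \<delta>) * t\<^sup>2 + \<delta> / (2 * D)"
      using D \<delta> by (simp add: field_simps power2_eq_square)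
    have "\<delta>\<^sup>2 / (2 * norm z) \<le> \<delta>\<^sup>2 / (2 * (a - \<delta>))"
      using nz \<delta> by (intro divide_left_mono) auto
    then have "\<bar>norm (z + w) - norm z\<bar> \<le> D / (2 * \<delta>) * t\<^sup>2 + (\<delta> / (2 * D) + \<delta>\<^sup>2 / (2 * (a - \<delta>)))"
      using norm_shift_bound[of z w] nz amgm unfolding t_def[symmetric] \<delta>_def[symmetric] by force
    then have "\<bar>norm (z + w) - norm z\<bar> / (1 - a) \<le> b z"
      unfolding b_def t2 S1 using a by (intro divide_right_mono) auto
    then show ?thesis
      using cutoff_lipschitz[of a "norm (z + w)" "norm z"] a by linarith
  qed
  have intb: "integrable lborel b"
    unfolding b_def[abs_def] using mom(1) intS
    by (intro integrable_divide Bochner_Integration.integrable_add integrable_mult_right) auto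
  have "shift_variation (\<lambda>z. cutoff a (norm z)) w \<le> (\<integral>z. b z \<partial>lborel)"
    unfolding shift_variation_def using pw intb a
    by (intro integral_mono shift_variation_integrable[unfolded shift_variation_def] cutoff_integrable) auto
  also have "\<dots> = (D / (2 * \<delta>) * (\<delta>\<^sup>2 / DIM('a) * measure lborel S)
     + (\<delta> / (2 * D) + \<delta>\<^sup>2 / (2 * (a - \<delta>))) * measure lborel S) / (1 - a)"
    unfolding b_def[abs_def] using mom intS
    by (simp add: Bochner_Integration.integral_add)
  also have "\<dots> = measure lborel S / (1 - a) * (\<delta> / D + \<delta>\<^sup>2 / (2 * (a - \<delta>)))"
  proof -
    have "D / (2 * \<delta>) * (\<delta>\<^sup>2 / DIM('a)) = \<delta> / (2 * D)"
      unfolding D(2)[symmetric] using D(1) \<delta> by (simp add: power2_eq_square field_simps)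
    then have e: "D / (2 * \<delta>) * (\<delta>\<^sup>2 / DIM('a) * m) = \<delta> / (2 * D) * m" for m
      by (simp only: mult.assoc[symmetric])
    show ?thesis unfolding e by (simp add: algebra_simps add_divide_distrib)
  qed
  also have "measure lborel S = unit_ball_vol DIM('a) * ((1 + \<delta>) ^ DIM('a) - (a - \<delta>) ^ DIM('a))"
    using \<delta> a by (intro mS) auto
  finally show ?thesis
    unfolding \<delta>_def D_def .
qed

text \<open>
  Cut the shift into \<open>n\<close> equal steps and let \<open>n\<close> grow: the second order term of the local bound disappears and
  the shell shrinks to \<open>a \<le> norm z \<le> 1\<close>. Its volume is at most \<open>d * (1 - a)\<close> times the volume of the ball by
  Bernoulli's inequality, which cancels the slope \<open>1 / (1 - a)\<close> and leaves \<open>d / sqrt d = sqrt d\<close>.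
\<close>

lemma shift_variation_cutoff:
  fixes w :: "'a::euclidean_space"
  assumes a: "0 < a" "a < 1"
  shows "shift_variation (\<lambda>z. cutoff a (norm z)) w \<le> unit_ball_vol DIM('a) * sqrt DIM('a) * norm w"
proof (cases "w = 0")
  case True
  then show ?thesis by (simp add: shift_variation_def)
next
  case False
  let ?d = "DIM('a)" and ?V = "unit_ball_vol DIM('a)"
  let ?T = "shift_variation (\<lambda>z::'a. cutoff a (norm z))"
  define B where "B n = ?V * ((1 + norm w / real n) ^ ?d - (a - norm w / real n) ^ ?d) / (1 - a) *
     (norm w / sqrt ?d + (norm w)\<^sup>2 / real n / (2 * (a - norm w / real n)))" for n
  have lim0: "(\<lambda>n. c / real n) \<longlonglongrightarrow> 0" for c
    by (rule lim_const_over_n)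
  have "B \<longlonglongrightarrow> ?V * ((1 + 0) ^ ?d - (a - 0) ^ ?d) / (1 - a) * (norm w / sqrt ?d + 0 / (2 * (a - 0)))"
    unfolding B_def[abs_def] using a by (intro tendsto_intros lim0) auto
  moreover have "eventually (\<lambda>n. ?T w \<le> B n) sequentially"
  proof -
    have "eventually (\<lambda>n. norm w / real n < a) sequentially"
      using order_tendstoD(2)[OF lim0 a(1)] .
    then show ?thesis
      using eventually_gt_at_top[of 0]
    proof eventually_elim
      case (elim n)
      have nw: "norm (w /\<^sub>R real n) = norm w / real n" using elim by (simp add: divide_inverse_commute)
      have "?T w = ?T (real n *\<^sub>R (w /\<^sub>R real n))" using elim by simp
      also have "\<dots> \<le> real n * ?T (w /\<^sub>R real n)"
        using a by (intro shift_variation_multiple cutoff_integrable) auto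
      also have "\<dots> \<le> real n * (?V * ((1 + norm w / n) ^ ?d - (a - norm w / n) ^ ?d) / (1 - a) *
         (norm w / n / sqrt ?d + (norm w / n)\<^sup>2 / (2 * (a - norm w / n))))"
        using shift_variation_cutoff_local[OF a, of "w /\<^sub>R real n"] False elim unfolding nw
        by (intro mult_left_mono) auto
      also have "\<dots> = ?V * ((1 + norm w / n) ^ ?d - (a - norm w / n) ^ ?d) / (1 - a) *
         (real n * (norm w / n / sqrt ?d + (norm w / n)\<^sup>2 / (2 * (a - norm w / n))))"
        by simp
      also have "real n * (norm w / n / sqrt ?d + (norm w / n)\<^sup>2 / (2 * (a - norm w / n))) =
         norm w / sqrt ?d + (norm w)\<^sup>2 / real n / (2 * (a - norm w / n))"
        using elim by (simp add: distrib_left power_divide power2_eq_square)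
      finally show ?case unfolding B_def .
    qed
  qed
  ultimately have "?T w \<le> ?V * (1 - a ^ ?d) / (1 - a) * (norm w / sqrt ?d)"
    using tendsto_lowerbound[of B _ sequentially "?T w"] by simp
  also have "\<dots> \<le> ?V * ?d * (norm w / sqrt ?d)"
  proof (intro mult_right_mono)
    have "1 + real ?d * (a - 1) \<le> (1 + (a - 1)) ^ ?d"
      using a by (intro Bernoulli_inequality) auto
    then have "1 - a ^ ?d \<le> real ?d * (1 - a)" by (simp add: algebra_simps)
    then have "?V * (1 - a ^ ?d) \<le> ?V * (real ?d * (1 - a))"
      by (intro mult_left_mono) auto
    then show "?V * (1 - a ^ ?d) / (1 - a) \<le> ?V * ?d"
      using a by (simp add: pos_divide_le_eq mult.assoc)
  qed auto
  also have "\<dots> = ?V * sqrt ?d * norm w"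
    by (simp add: field_simps real_div_sqrt)
  finally show ?thesis .
qed

text \<open>
  The bound for the cutoffs does not depend on \<open>a\<close>, and they converge to the indicator in L1 as \<open>a\<close> tends to \<open>1\<close>.
  In dimension one the constant \<open>sqrt d\<close> is attained by small shifts.
\<close>

lemma shift_variation_unit_ball:
  fixes w :: "'a::euclidean_space"
  shows "shift_variation (indicator (cball 0 1)) w \<le> unit_ball_vol DIM('a) * sqrt DIM('a) * norm w"
proof -
  let ?d = "DIM('a)" and ?V = "unit_ball_vol DIM('a)"
  have intB: "integrable lborel (indicator (cball (0::'a) 1) :: 'a \<Rightarrow> real)"
    by (intro integrable_real_indicator) (auto simp: emeasure_bounded_less_top)
  have bound: "shift_variation (indicator (cball 0 1)) w \<le>
      ?V * sqrt ?d * norm w + 2 * (?V * (1 - a ^ ?d))" if a: "a \<in> {0<..<1}" for a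
  proof -
    have "(\<integral>z. \<bar>indicator (cball (0::'a) 1) z - cutoff a (norm z)\<bar> \<partial>lborel) \<le> (\<integral>z. indicator (shell a 1 :: 'a set) z \<partial>lborel)"
    proof (intro integral_mono)
      show "integrable lborel (\<lambda>z. \<bar>indicator (cball (0::'a) 1) z - cutoff a (norm z)\<bar>)"
        using intB cutoff_integrable[of a, where 'a='a] a
        by (intro integrable_abs Bochner_Integration.integrable_diff) auto
      show "integrable lborel (indicator (shell a 1 :: 'a set) :: 'a \<Rightarrow> real)"
        using measure_shell(1)[of a 1, where 'a='a] a by (intro integrable_real_indicator) auto
      show "\<bar>indicator (cball (0::'a) 1) z - cutoff a (norm z)\<bar> \<le> indicator (shell a 1) z" for z :: 'a
        using a cutoff_bounds[of a "norm z"]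
        by (auto simp: indicator_def shell_def cutoff_eq_1 cutoff_eq_0)
    qed
    also have "\<dots> = ?V * (1 - a ^ ?d)"
      using a by (simp add: measure_shell)
    finally show ?thesis
      using shift_variation_perturb[OF intB cutoff_integrable[of a], of w] shift_variation_cutoff[of a w] a
      by auto
  qed
  have "((\<lambda>a. ?V * sqrt ?d * norm w + 2 * (?V * (1 - a ^ ?d))) \<longlongrightarrow>
     ?V * sqrt ?d * norm w + 2 * (?V * (1 - 1 ^ ?d))) (at_left 1)"
    by (intro tendsto_intros)
  moreover have "eventually (\<lambda>a. shift_variation (indicator (cball 0 1)) w \<le>
      ?V * sqrt ?d * norm w + 2 * (?V * (1 - a ^ ?d))) (at_left 1)"
    using eventually_at_left_real[of 0 1] by (auto elim!: eventually_mono intro!: bound)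
  ultimately show ?thesis
    using tendsto_lowerbound[of _ _ "at_left (1::real)"] by fastforce
qed

section \<open>Convex functions with bounded second differences, and convex extension\<close>

text \<open>
  Separate the point of the graph over \<open>x\<close> from the strict epigraph. The separating hyperplane is not vertical because
  the function is finite everywhere.
\<close>

lemma convex_on_UNIV_imp_subgradient:
  fixes F :: "'a::euclidean_space \<Rightarrow> real"
  assumes F: "convex_on UNIV F"
  obtains g where "\<And>y. F x + g \<bullet> (y - x) \<le> F y"
proof -
  define T where "T = {(y, r). F y < r}"
  have "convex T"
  proof (rule convexI)
    fix p q :: "'a \<times> real" and u v :: real
    assume p: "p \<in> T" and q: "q \<in> T" and uv: "0 \<le> u" "0 \<le> v" "u + v = 1"
    have "F (u *\<^sub>R fst p + v *\<^sub>R fst q) \<le> u * F (fst p) + v * F (fst q)"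
      using F uv by (auto simp: convex_on_def)
    also have "\<dots> < u * snd p + v * snd q"
    proof -
      have "F (fst p) < snd p" "F (fst q) < snd q" using p q by (auto simp: T_def)
      then show ?thesis
        using uv by (cases "u = 0") (auto intro!: add_less_le_mono mult_left_mono mult_strict_left_mono)
    qed
    finally show "u *\<^sub>R p + v *\<^sub>R q \<in> T"
      by (auto simp: T_def split_beta)
  qed
  moreover have "(x, F x + 1) \<in> T" by (simp add: T_def)
  moreover have "{(x, F x)} \<inter> T = {}" by (auto simp: T_def)
  ultimately obtain p c where p: "p \<noteq> 0" "\<forall>q\<in>{(x, F x)}. p \<bullet> q \<le> c" "\<forall>q\<in>T. c \<le> p \<bullet> q"
    using separating_hyperplane_sets[of "{(x, F x)}" T] by blast
  obtain a \<alpha> where p_eq: "p = (a, \<alpha>)" by (cases p)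
  have sep: "0 \<le> a \<bullet> (y - x) + \<alpha> * (r - F x)" if "F y < r" for y r
    using p(2,3) that by (force simp: T_def p_eq inner_diff_right algebra_simps)
  have "\<alpha> \<ge> 0" using sep[of x "F x + 1"] by simp
  moreover have "\<alpha> \<noteq> 0"
  proof
    assume 0: "\<alpha> = 0"
    have "0 \<le> a \<bullet> ((x - a) - x)" using sep[of "x - a" "F (x - a) + 1"] 0 by simp
    then have "a = 0" using inner_gt_zero_iff[of a] by (simp add: not_le[symmetric])
    with 0 p(1) p_eq show False by (simp add: zero_prod_def)
  qed
  ultimately have \<alpha>: "\<alpha> > 0" by simp
  show ?thesis
  proof
    fix y
    show "F x + (- (a /\<^sub>R \<alpha>)) \<bullet> (y - x) \<le> F y"
    proof (rule dense_ge)
      fix r assume "F y < r"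
      from sep[OF this] have "- (a \<bullet> (y - x)) \<le> (r - F x) * \<alpha>" by (simp add: mult.commute)
      then have "- (a \<bullet> (y - x)) / \<alpha> \<le> r - F x" by (subst pos_divide_le_eq[OF \<alpha>])
      then show "F x + (- (a /\<^sub>R \<alpha>)) \<bullet> (y - x) \<le> r"
        using \<alpha> by (simp add: divide_inverse_commute)
    qed
  qed
qed

text \<open>
  Let \<open>e x w\<close> be the error of the linearisation at \<open>x\<close> given by some subgradient. It is nonnegative, and
  \<open>e x w + e x (- w)\<close> is a second difference, so \<open>e x w\<close> is quadratically small and the function is differentiable.
  For the sharp Lipschitz constant the bound \<open>C (norm w)\<^sup>2\<close> on \<open>e\<close> is first improved by a factor two, by iterating
  the second difference inequality at the midpoint; cocoercivity of the gradient then follows as usual by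
  comparing linearisations at two points.
\<close>

lemma convex_second_difference_imp_smooth:
  fixes F :: "'a::euclidean_space \<Rightarrow> real"
  assumes F: "convex_on UNIV F" and C: "C > 0"
    and sd: "\<And>x w. F (x + w) - 2 * F x + F (x - w) \<le> C * (norm w)\<^sup>2"
  obtains G where "\<And>x. (F has_derivative (\<lambda>w. G x \<bullet> w)) (at x)" "C-lipschitz_on UNIV G"
proof -
  have "\<exists>g. \<forall>y. F x + g \<bullet> (y - x) \<le> F y" for x
    using convex_on_UNIV_imp_subgradient[OF F] by metis
  then obtain G where G: "\<And>x y. F x + G x \<bullet> (y - x) \<le> F y" by metis
  define e where "e x w = F (x + w) - F x - G x \<bullet> w" for x w
  have e0: "0 \<le> e x w" for x w using G[of x "x + w"] by (simp add: e_def)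
  have e1: "e x w \<le> C * (norm w)\<^sup>2" for x w
    using sd[of x w] e0[of x "- w"] by (simp add: e_def)
  have halve: "e x w \<le> 2 * e x (w /\<^sub>R 2) + C * (norm w)\<^sup>2 / 4" for x w
  proof -
    have 1: "x + w /\<^sub>R 2 + w /\<^sub>R 2 = x + w" "x + w /\<^sub>R 2 - w /\<^sub>R 2 = x"
      by (simp_all add: algebra_simps scaleR_2[symmetric] flip: scaleR_add_left)
    have "F (x + w) - 2 * F (x + w /\<^sub>R 2) + F x \<le> C * (norm (w /\<^sub>R 2))\<^sup>2"
      using sd[of "x + w /\<^sub>R 2" "w /\<^sub>R 2"] unfolding 1 .
    then show ?thesis by (simp add: e_def power_divide power_mult_distrib)
  qed
  have "e x w \<le> C * (norm w)\<^sup>2 * (1 / 2 + (1 / 2) * (1 / 2) ^ n)" for x w n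
  proof (induction n arbitrary: w)
    case 0
    then show ?case using e1[of x w] by simp
  next
    case (Suc n)
    have "e x w \<le> 2 * (C * (norm (w /\<^sub>R 2))\<^sup>2 * (1 / 2 + (1 / 2) * (1 / 2) ^ n)) + C * (norm w)\<^sup>2 / 4"
      using halve[of x w] Suc.IH[of "w /\<^sub>R 2"] by linarith
    then show ?case by (simp add: power_mult_distrib power_divide field_simps)
  qed
  moreover have "(\<lambda>n. C * (norm w)\<^sup>2 * (1 / 2 + (1 / 2) * (1 / 2) ^ n)) \<longlonglongrightarrow> C * (norm w)\<^sup>2 * (1 / 2 + (1 / 2) * 0)"
    for w :: 'a
    by (intro tendsto_intros LIMSEQ_realpow_zero) auto
  ultimately have e: "e x w \<le> C * (norm w)\<^sup>2 * (1 / 2 + (1 / 2) * 0)" for x w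
    using LIMSEQ_le_const by blast
  show ?thesis
  proof
    fix x
    show "(F has_derivative (\<lambda>w. G x \<bullet> w)) (at x)"
      unfolding has_derivative_at_alt
    proof (intro conjI allI impI)
      show "bounded_linear ((\<bullet>) (G x))" by (rule bounded_linear_inner_right)
      fix \<epsilon> :: real assume \<epsilon>: "\<epsilon> > 0"
      show "\<exists>d>0. \<forall>y. norm (y - x) < d \<longrightarrow> norm (F y - F x - G x \<bullet> (y - x)) \<le> \<epsilon> * norm (y - x)"
      proof (intro exI[of _ "\<epsilon> / C"] conjI allI impI)
        fix y assume y: "norm (y - x) < \<epsilon> / C"
        have "norm (F y - F x - G x \<bullet> (y - x)) \<le> C * (norm (y - x))\<^sup>2"
          using e0[of x "y - x"] e1[of x "y - x"] by (simp add: e_def)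
        also have "\<dots> = (C * norm (y - x)) * norm (y - x)" by (simp add: power2_eq_square)
        also have "\<dots> \<le> \<epsilon> * norm (y - x)"
          using y C by (intro mult_right_mono) (auto simp: field_simps)
        finally show "norm (F y - F x - G x \<bullet> (y - x)) \<le> \<epsilon> * norm (y - x)" .
      qed (use \<epsilon> C in simp)
    qed
  next
    \<comment> \<open>a gradient step of length \<open>1 / C\<close> from \<open>y\<close> for the function \<open>e x\<close>, which stays nonnegative\<close>
    have coco: "(norm (G y - G x))\<^sup>2 / (2 * C) \<le> e x (y - x)" for x y
    proof -
      define u where "u = - ((G y - G x) /\<^sub>R C)"
      have "0 \<le> e x (y + u - x)" by (rule e0)
      also have "\<dots> = e x (y - x) + (G y - G x) \<bullet> u + e y u"
        by (simp add: e_def inner_simps algebra_simps)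
      also have "\<dots> \<le> e x (y - x) + (G y - G x) \<bullet> u + C * (norm u)\<^sup>2 / 2"
        using e[of y u] by simp
      also have "(G y - G x) \<bullet> u = - ((norm (G y - G x))\<^sup>2 / C)"
        by (simp add: u_def power2_norm_eq_inner divide_inverse_commute)
      also have "C * (norm u)\<^sup>2 / 2 = (norm (G y - G x))\<^sup>2 / (2 * C)"
      proof -
        have "norm u = norm (G y - G x) / C"
          using C by (simp only: u_def norm_minus_cancel norm_scaleR) (simp add: divide_inverse_commute)
        then show ?thesis using C by (simp add: power2_eq_square)
      qed
      finally show ?thesis using C by (simp add: field_simps)
    qed
    show "C-lipschitz_on UNIV G"
    proof (rule lipschitz_onI)
      fix x y
      have "(norm (G y - G x))\<^sup>2 / (2 * C) + (norm (G x - G y))\<^sup>2 / (2 * C) \<le> e x (y - x) + e y (x - y)"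
        by (intro add_mono coco)
      also have "\<dots> = (G y - G x) \<bullet> (y - x)"
        by (simp add: e_def inner_simps algebra_simps)
      also have "\<dots> \<le> norm (G y - G x) * norm (y - x)"
        by (rule norm_cauchy_schwarz)
      finally have "norm (G y - G x) * norm (G y - G x) \<le> norm (G y - G x) * (C * norm (y - x))"
        using C by (simp add: norm_minus_commute power2_eq_square field_simps)
      then have "norm (G y - G x) \<le> C * norm (y - x)"
        using C by (cases "norm (G y - G x) = 0") (auto dest: mult_left_le_imp_le)
      then show "dist (G x) (G y) \<le> C * dist x y"
        by (simp add: dist_norm norm_minus_commute)
    qed (use C in simp)
  qed
qed

text \<open>
  The infimal convolution of the function with \<open>L * norm\<close> is Lipschitz as an infimum of Lipschitz functions, and
  convex as a partial infimum of a jointly convex function.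
\<close>

lemma convex_lipschitz_extension:
  fixes F :: "'a::euclidean_space \<Rightarrow> real"
  assumes F: "convex_on U F" and L: "L-lipschitz_on U F" and U: "U \<noteq> {}"
  obtains F' where "convex_on UNIV F'" "L-lipschitz_on UNIV F'" "\<And>x. x \<in> U \<Longrightarrow> F' x = F x"
proof -
  have L0: "0 \<le> L" using L by (rule lipschitz_on_nonneg)
  have lip: "\<bar>F u - F v\<bar> \<le> L * norm (u - v)" if "u \<in> U" "v \<in> U" for u v
    using lipschitz_onD[OF L that] by (simp add: dist_norm)
  obtain u0 where u0: "u0 \<in> U" using U by blast
  define q where "q y u = F u + L * norm (y - u)" for y u
  define F' where "F' y = (INF u\<in>U. q y u)" for y
  have q_lower: "F v - L * norm (y - v) \<le> q y u" if "u \<in> U" "v \<in> U" for u v y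
  proof -
    have "L * norm (u - v) \<le> L * (norm (y - u) + norm (y - v))"
      using norm_triangle_ineq4[of "y - v" "y - u"] L0 by (intro mult_left_mono) auto
    with lip[OF that] show ?thesis by (simp add: q_def algebra_simps)
  qed
  have bdd: "bdd_below (q y ` U)" for y
    using q_lower[OF _ u0] by (auto intro!: bdd_belowI2)
  have le: "F' y \<le> q y u" if "u \<in> U" for y u
    unfolding F'_def using bdd that by (intro cINF_lower) auto
  have ge: "c \<le> F' y" if "\<And>u. u \<in> U \<Longrightarrow> c \<le> q y u" for c y
    unfolding F'_def using U that by (intro cINF_greatest) auto
  have near: "\<exists>u\<in>U. q y u < F' y + \<epsilon>" if "\<epsilon> > 0" for y \<epsilon>
    using ge[of "F' y + \<epsilon>" y] that by fastforce
  show ?thesis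
  proof
    show "F' x = F x" if "x \<in> U" for x
      using le[OF that, of x] ge[of "F x" x] q_lower[OF _ that, of _ x] by (force simp: q_def)
    show "L-lipschitz_on UNIV F'"
    proof (rule lipschitz_onI[OF _ L0])
      have *: "F' y - L * norm (y - y') \<le> F' y'" for y y'
      proof (rule ge)
        fix u assume u: "u \<in> U"
        have "L * norm (y - u) \<le> L * (norm (y' - u) + norm (y - y'))"
          using norm_triangle_ineq[of "y' - u" "y - y'"] L0 by (intro mult_left_mono) auto
        then show "F' y - L * norm (y - y') \<le> q y' u"
          using le[OF u, of y] by (simp add: q_def algebra_simps)
      qed
      show "dist (F' x) (F' y) \<le> L * dist x y" for x y
        using *[of x y] *[of y x] by (simp add: dist_norm norm_minus_commute)
    qed
    show "convex_on UNIV F'"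
    proof (rule convex_onI)
      fix t :: real and x y :: 'a
      assume t: "0 < t" "t < 1"
      show "F' ((1 - t) *\<^sub>R x + t *\<^sub>R y) \<le> (1 - t) * F' x + t * F' y"
      proof (rule field_le_epsilon)
        fix \<epsilon> :: real assume "\<epsilon> > 0"
        from near[OF this, of x] near[OF this, of y] obtain u v
          where u: "u \<in> U" "q x u < F' x + \<epsilon>" and v: "v \<in> U" "q y v < F' y + \<epsilon>" by blast
        let ?z = "(1 - t) *\<^sub>R u + t *\<^sub>R v"
        have z: "?z \<in> U"
          using convex_on_imp_convex[OF F] u v t by (auto intro: convexD)
        have "norm ((1 - t) *\<^sub>R x + t *\<^sub>R y - ?z) = norm ((1 - t) *\<^sub>R (x - u) + t *\<^sub>R (y - v))"
          by (simp add: algebra_simps)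
        also have "\<dots> \<le> (1 - t) * norm (x - u) + t * norm (y - v)"
          using norm_triangle_ineq[of "(1 - t) *\<^sub>R (x - u)" "t *\<^sub>R (y - v)"] t by simp
        finally have n: "L * norm ((1 - t) *\<^sub>R x + t *\<^sub>R y - ?z) \<le> L * ((1 - t) * norm (x - u) + t * norm (y - v))"
          using L0 by (rule mult_left_mono)
        have "F' ((1 - t) *\<^sub>R x + t *\<^sub>R y) \<le> q ((1 - t) *\<^sub>R x + t *\<^sub>R y) ?z"
          by (rule le[OF z])
        also have "\<dots> \<le> ((1 - t) * F u + t * F v) + L * ((1 - t) * norm (x - u) + t * norm (y - v))"
          unfolding q_def using convex_onD[OF F, of t u v] u v t n by (intro add_mono) auto
        also have "\<dots> = (1 - t) * q x u + t * q y v"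
          by (simp add: q_def algebra_simps)
        also have "\<dots> \<le> (1 - t) * (F' x + \<epsilon>) + t * (F' y + \<epsilon>)"
          using u v t by (intro add_mono mult_left_mono) auto
        also have "\<dots> = (1 - t) * F' x + t * F' y + \<epsilon>" by (simp add: algebra_simps)
        finally show "F' ((1 - t) *\<^sub>R x + t *\<^sub>R y) \<le> (1 - t) * F' x + t * F' y + \<epsilon>" .
      qed
    qed simp
  qed
qed

section \<open>Averages over balls\<close>

lemma unit_cball_measurable [measurable]: "cball (0::'a::euclidean_space) 1 \<in> sets borel"
  by simp

lemma unit_ball_vol_DIM: "unit_ball_vol DIM('a::euclidean_space) > 0" "unit_ball_vol DIM('a) \<noteq> 0"
  using unit_ball_vol_pos[of "DIM('a)"] by (simp_all add: less_imp_neq[symmetric] del: unit_ball_vol_pos)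

text \<open>
  The uniform distribution on the closed unit ball, with its density written as in the law of the perturbation.
\<close>

definition unif_ball :: "'a::euclidean_space measure" where
  "unif_ball = density lborel (\<lambda>y. ennreal (indicator (cball 0 1) y / measure lborel (cball (0::'a) 1)))"

lemma sets_unif_ball [simp, measurable_cong]: "sets unif_ball = sets borel"
  by (simp add: unif_ball_def)

lemma space_unif_ball [simp]: "space unif_ball = UNIV"
  by (simp add: unif_ball_def)

lemma content_unit_cball: "measure lborel (cball (0::'a::euclidean_space) 1) = unit_ball_vol DIM('a)"
  by (simp add: content_cball)

lemma prob_space_unif_ball: "prob_space (unif_ball :: 'a::euclidean_space measure)"
proof
  let ?V = "measure lborel (cball (0::'a) 1)"
  have V: "?V > 0" by (simp add: content_unit_cball)
  have "emeasure unif_ball (space unif_ball :: 'a set) = (\<integral>\<^sup>+ y. ennreal (1 / ?V) * indicator (cball 0 1) (y::'a) \<partial>lborel)"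
    by (auto simp: unif_ball_def emeasure_density indicator_def intro!: nn_integral_cong)
  also have "\<dots> = ennreal (1 / ?V) * emeasure lborel (cball (0::'a) 1)"
    by (subst nn_integral_cmult) auto
  also have "emeasure lborel (cball (0::'a) 1) = ennreal ?V"
    by (intro emeasure_eq_ennreal_measure) (simp add: emeasure_bounded_less_top less_imp_neq)
  also have "ennreal (1 / ?V) * ennreal ?V = 1"
    using V by (simp flip: ennreal_mult)
  finally show "emeasure unif_ball (space unif_ball :: 'a set) = 1" .
qed

lemma AE_unif_ball: "AE z in unif_ball. norm (z::'a::euclidean_space) < 1"
proof -
  have "sphere (0::'a) 1 \<in> null_sets lborel"
    using negligible_sphere[of "0::'a" 1]
    by (auto simp: null_sets_completion_iff negligible_iff_null_sets)
  then have "AE z in lborel. z \<notin> sphere (0::'a) 1"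
    by (rule AE_not_in)
  then show ?thesis
    unfolding unif_ball_def
    by (subst AE_density) (auto elim!: eventually_mono simp: indicator_def split: if_splits)
qed

lemma integral_unif_ball:
  fixes F :: "'a::euclidean_space \<Rightarrow> real"
  assumes [measurable]: "F \<in> borel_measurable borel"
  shows "(\<integral>z. F z \<partial>unif_ball) = (\<integral>z. indicator (cball 0 1) z * F z \<partial>lborel) / unit_ball_vol DIM('a)"
  unfolding unif_ball_def by (subst integral_density) (auto simp: content_unit_cball)

lemma integrable_unif_ball:
  fixes F :: "'a::euclidean_space \<Rightarrow> real"
  assumes F: "continuous_on UNIV F"
  shows "integrable lborel (\<lambda>z. indicator (cball 0 1) z * F z)" "integrable unif_ball F"
proof -
  have [measurable]: "F \<in> borel_measurable borel"
    using F by (rule borel_measurable_continuous_onI)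
  show 1: "integrable lborel (\<lambda>z. indicator (cball 0 1) z * F z)"
    using borel_integrable_compact[of "cball 0 1" F] F continuous_on_subset by fastforce
  show "integrable unif_ball F"
    unfolding unif_ball_def using 1 by (subst integrable_density) auto
qed

definition ball_average :: "('a::euclidean_space \<Rightarrow> real) \<Rightarrow> real \<Rightarrow> 'a \<Rightarrow> real" where
  "ball_average F \<mu> x = (\<integral>z. F (x + \<mu> *\<^sub>R z) \<partial>unif_ball)"

text \<open>
  Shifting the integration variable moves two of the four terms onto the translated ball, so that the second
  difference becomes the integral of \<open>k (y + z + w) - k (y + z)\<close> against the difference of the two indicators. This
  trades smoothness of \<open>k\<close>, of which one derivative is missing, for regularity of the ball.
\<close>

lemma unit_ball_average_second_difference:
  fixes k :: "'a::euclidean_space \<Rightarrow> real"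
  assumes L: "L-lipschitz_on UNIV k"
  shows "ball_average k 1 (y + w) - 2 * ball_average k 1 y + ball_average k 1 (y - w) \<le>
     L * sqrt DIM('a) * (norm w)\<^sup>2"
proof -
  let ?V = "unit_ball_vol DIM('a)"
  let ?B = "indicator (cball (0::'a) 1) :: 'a \<Rightarrow> real"
  note V = unit_ball_vol_DIM[where 'a='a]
  have L0: "0 \<le> L" using L by (rule lipschitz_on_nonneg)
  have cont: "continuous_on UNIV k" using L by (rule lipschitz_on_continuous_on)
  have km [measurable]: "k \<in> borel_measurable borel"
    using cont by (rule borel_measurable_continuous_onI)
  have J: "?V * ball_average k 1 x = (\<integral>z. ?B z * k (x + z) \<partial>lborel)" for x
    unfolding ball_average_def using V by (subst integral_unif_ball) auto
  have i0: "integrable lborel (\<lambda>z. ?B z * k (x + z))" for x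
    by (rule integrable_unif_ball(1), rule continuous_on_compose2[OF cont]) (auto intro!: continuous_intros)
  have s1: "(\<integral>z. ?B (z + w) * k (y + z + w) \<partial>lborel) = ?V * ball_average k 1 y"
    unfolding J using lborel_integral_translate[of "\<lambda>z. ?B z * k (y + z)" w] by (simp add: add.assoc)
  have s2: "(\<integral>z. ?B (z + w) * k (y + z) \<partial>lborel) = ?V * ball_average k 1 (y - w)"
    unfolding J using lborel_integral_translate[of "\<lambda>z. ?B z * k (y - w + z)" w] by (simp add: algebra_simps)
  have s3: "(\<integral>z. ?B z * k (y + z + w) \<partial>lborel) = ?V * ball_average k 1 (y + w)"
    unfolding J by (simp add: algebra_simps)
  have i1: "integrable lborel (\<lambda>z. ?B (z + w) * k (y + z + w))"
    using lborel_integrable_translate[OF i0[of y], of w] by (simp add: add.assoc)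
  have i2: "integrable lborel (\<lambda>z. ?B (z + w) * k (y + z))"
    using lborel_integrable_translate[OF i0[of "y - w"], of w] by (simp add: algebra_simps)
  have i3: "integrable lborel (\<lambda>z. ?B z * k (y + z + w))"
    using i0[of "y + w"] by (simp add: algebra_simps)
  have intB: "integrable lborel ?B"
    by (intro integrable_real_indicator) (auto simp: emeasure_bounded_less_top)
  have "?V * (ball_average k 1 (y + w) - 2 * ball_average k 1 y + ball_average k 1 (y - w)) =
     (\<integral>z. (?B z * k (y + z + w) - ?B z * k (y + z)) - (?B (z + w) * k (y + z + w) - ?B (z + w) * k (y + z)) \<partial>lborel)"
    unfolding Bochner_Integration.integral_diff[OF Bochner_Integration.integrable_diff[OF i3 i0] Bochner_Integration.integrable_diff[OF i1 i2]]
      Bochner_Integration.integral_diff[OF i3 i0] Bochner_Integration.integral_diff[OF i1 i2] s1 s2 s3 J[symmetric]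
    by (simp add: algebra_simps)
  also have "\<dots> \<le> (\<integral>z. L * norm w * \<bar>?B (z + w) - ?B z\<bar> \<partial>lborel)"
  proof (intro integral_mono Bochner_Integration.integrable_diff integrable_mult_right shift_variation_integrable i0 i1 i2 i3 intB)
    fix z
    have "(?B z * k (y + z + w) - ?B z * k (y + z)) - (?B (z + w) * k (y + z + w) - ?B (z + w) * k (y + z)) =
        (k (y + z + w) - k (y + z)) * (?B z - ?B (z + w))" by (simp add: algebra_simps)
    also have "\<dots> \<le> \<bar>k (y + z + w) - k (y + z)\<bar> * \<bar>?B (z + w) - ?B z\<bar>"
      by (metis abs_ge_self abs_minus_commute abs_mult)
    also have "\<dots> \<le> (L * norm w) * \<bar>?B (z + w) - ?B z\<bar>"
      using lipschitz_onD[OF L, of "y + z + w" "y + z"] by (intro mult_right_mono) (auto simp: dist_norm)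
    finally show "(?B z * k (y + z + w) - ?B z * k (y + z)) - (?B (z + w) * k (y + z + w) - ?B (z + w) * k (y + z))
       \<le> L * norm w * \<bar>?B (z + w) - ?B z\<bar>" .
  qed
  also have "\<dots> = L * norm w * shift_variation ?B w"
    by (simp add: shift_variation_def)
  also have "\<dots> \<le> L * norm w * (?V * sqrt DIM('a) * norm w)"
    using L0 by (intro mult_left_mono shift_variation_unit_ball) auto
  also have "\<dots> = ?V * (L * sqrt DIM('a) * (norm w)\<^sup>2)"
    by (simp add: power2_eq_square)
  finally show ?thesis using V(1) by (simp only: mult_le_cancel_left_pos)
qed

text \<open>
  Rescaling space by \<open>\<mu>\<close> multiplies the Lipschitz constant by \<open>\<mu>\<close> and divides the shift by it.
\<close>

lemma ball_average_second_difference: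
  fixes F :: "'a::euclidean_space \<Rightarrow> real"
  assumes L: "L-lipschitz_on UNIV F" and \<mu>: "\<mu> > 0"
  shows "ball_average F \<mu> (x + w) - 2 * ball_average F \<mu> x + ball_average F \<mu> (x - w) \<le>
     L * sqrt DIM('a) / \<mu> * (norm w)\<^sup>2"
proof -
  define k where "k z = F (\<mu> *\<^sub>R z)" for z
  have k: "(L * \<mu>)-lipschitz_on UNIV k"
  proof (rule lipschitz_onI)
    show "dist (k x) (k y) \<le> L * \<mu> * dist x y" for x y
      using lipschitz_onD[OF L, of "\<mu> *\<^sub>R x" "\<mu> *\<^sub>R y"] \<mu>
      by (simp add: k_def dist_norm mult.assoc flip: scaleR_diff_right)
  qed (use \<mu> lipschitz_on_nonneg[OF L] in simp)
  have e: "ball_average F \<mu> y = ball_average k 1 (y /\<^sub>R \<mu>)" for y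
    using \<mu> by (simp add: ball_average_def k_def scaleR_add_right)
  have "ball_average F \<mu> (x + w) - 2 * ball_average F \<mu> x + ball_average F \<mu> (x - w) \<le>
     (L * \<mu>) * sqrt DIM('a) * (norm (w /\<^sub>R \<mu>))\<^sup>2"
    unfolding e scaleR_add_right scaleR_diff_right by (rule unit_ball_average_second_difference[OF k])
  also have "\<dots> = L * sqrt DIM('a) / \<mu> * (norm w)\<^sup>2"
    using \<mu> by (simp add: power_mult_distrib field_simps power2_eq_square)
  finally show ?thesis .
qed

lemma lipschitz_integrable_unif_ball:
  fixes F :: "'a::euclidean_space \<Rightarrow> real"
  assumes "L-lipschitz_on UNIV F"
  shows "integrable unif_ball (\<lambda>z. F (x + \<mu> *\<^sub>R z))"
  using lipschitz_on_continuous_on[OF assms]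
  by (rule integrable_unif_ball(2)[OF continuous_on_compose2]) (auto intro!: continuous_intros)

lemma ball_average_convex:
  fixes F :: "'a::euclidean_space \<Rightarrow> real"
  assumes F: "convex_on UNIV F" and L: "L-lipschitz_on UNIV F"
  shows "convex_on UNIV (ball_average F \<mu>)"
proof (rule convex_onI)
  fix t :: real and x y :: 'a
  assume t: "0 < t" "t < 1"
  note int = lipschitz_integrable_unif_ball[OF L]
  have "ball_average F \<mu> ((1 - t) *\<^sub>R x + t *\<^sub>R y) \<le>
      (\<integral>z. (1 - t) * F (x + \<mu> *\<^sub>R z) + t * F (y + \<mu> *\<^sub>R z) \<partial>unif_ball)"
    unfolding ball_average_def
  proof (intro integral_mono Bochner_Integration.integrable_add integrable_mult_right int)
    fix z
    have "(1 - t) *\<^sub>R x + t *\<^sub>R y + \<mu> *\<^sub>R z = (1 - t) *\<^sub>R (x + \<mu> *\<^sub>R z) + t *\<^sub>R (y + \<mu> *\<^sub>R z)"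
      by (simp add: algebra_simps)
    then show "F ((1 - t) *\<^sub>R x + t *\<^sub>R y + \<mu> *\<^sub>R z) \<le> (1 - t) * F (x + \<mu> *\<^sub>R z) + t * F (y + \<mu> *\<^sub>R z)"
      using convex_onD[OF F, of t "x + \<mu> *\<^sub>R z" "y + \<mu> *\<^sub>R z"] t by simp
  qed
  also have "\<dots> = (1 - t) * ball_average F \<mu> x + t * ball_average F \<mu> y"
    unfolding ball_average_def using int by (simp add: Bochner_Integration.integral_add)
  finally show "ball_average F \<mu> ((1 - t) *\<^sub>R x + t *\<^sub>R y) \<le>
     (1 - t) * ball_average F \<mu> x + t * ball_average F \<mu> y" .
qed simp

lemma ball_average_lipschitz:
  fixes F :: "'a::euclidean_space \<Rightarrow> real"
  assumes L: "L-lipschitz_on UNIV F"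
  shows "\<bar>ball_average F \<mu> x - ball_average F \<nu> y\<bar> \<le> L * (norm (x - y) + \<bar>\<mu> - \<nu>\<bar>)"
proof -
  interpret prob_space "unif_ball :: 'a measure" by (rule prob_space_unif_ball)
  note int = lipschitz_integrable_unif_ball[OF L]
  have L0: "0 \<le> L" using L by (rule lipschitz_on_nonneg)
  have "\<bar>ball_average F \<mu> x - ball_average F \<nu> y\<bar> = \<bar>\<integral>z. F (x + \<mu> *\<^sub>R z) - F (y + \<nu> *\<^sub>R z) \<partial>unif_ball\<bar>"
    unfolding ball_average_def using int by (simp add: Bochner_Integration.integral_diff)
  also have "\<dots> \<le> (\<integral>z. \<bar>F (x + \<mu> *\<^sub>R z) - F (y + \<nu> *\<^sub>R z)\<bar> \<partial>unif_ball)"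
    by (rule integral_abs_bound)
  also have "\<dots> \<le> (\<integral>z. L * (norm (x - y) + \<bar>\<mu> - \<nu>\<bar>) \<partial>(unif_ball :: 'a measure))"
  proof (intro integral_mono_AE integrable_abs Bochner_Integration.integrable_diff int integrable_const)
    show "AE z in unif_ball. \<bar>F (x + \<mu> *\<^sub>R z) - F (y + \<nu> *\<^sub>R z)\<bar> \<le> L * (norm (x - y) + \<bar>\<mu> - \<nu>\<bar>)"
      using AE_unif_ball
    proof eventually_elim
      case (elim z)
      have "\<bar>F (x + \<mu> *\<^sub>R z) - F (y + \<nu> *\<^sub>R z)\<bar> \<le> L * norm ((x - y) + (\<mu> - \<nu>) *\<^sub>R z)"
        using lipschitz_onD[OF L, of "x + \<mu> *\<^sub>R z" "y + \<nu> *\<^sub>R z"] by (simp add: dist_norm algebra_simps)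
      also have "norm ((x - y) + (\<mu> - \<nu>) *\<^sub>R z) \<le> norm (x - y) + \<bar>\<mu> - \<nu>\<bar> * norm z"
        using norm_triangle_ineq[of "x - y" "(\<mu> - \<nu>) *\<^sub>R z"] by simp
      also have "\<bar>\<mu> - \<nu>\<bar> * norm z \<le> \<bar>\<mu> - \<nu>\<bar>"
        using elim by (simp add: mult_left_le)
      finally show ?case using L0 by (simp add: mult_left_mono)
    qed
  qed
  also have "\<dots> = L * (norm (x - y) + \<bar>\<mu> - \<nu>\<bar>)" using prob_space by simp
  finally show ?thesis .
qed

lemma ball_average_zero [simp]: "ball_average F 0 x = F x"
proof -
  interpret prob_space "unif_ball :: 'a measure" by (rule prob_space_unif_ball)
  show ?thesis using prob_space by (simp add: ball_average_def)
qed

lemma ball_average_gradient: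
  fixes F :: "'a::euclidean_space \<Rightarrow> real"
  assumes F: "convex_on UNIV F" and L: "L-lipschitz_on UNIV F" "L > 0" and \<mu>: "\<mu> > 0"
  obtains G where "\<And>x. (ball_average F \<mu> has_derivative (\<lambda>w. G x \<bullet> w)) (at x)"
    "(L * sqrt DIM('a) / \<mu>)-lipschitz_on UNIV G"
proof (rule convex_second_difference_imp_smooth)
  show "convex_on UNIV (ball_average F \<mu>)" using ball_average_convex[OF F L(1)] .
  show "0 < L * sqrt DIM('a) / \<mu>" using L \<mu> by simp
qed (use ball_average_second_difference[OF L(1) \<mu>] that in auto)

section \<open>Extended-real expectations and norms of subdifferentials\<close>

lemma ext_expectation_eq_integral:
  assumes z: "integrable M z" and Z: "AE \<omega> in M. Z \<omega> = ereal (z \<omega>)"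
  shows "ext_expectation M Z = ereal (\<integral>\<omega>. z \<omega> \<partial>M)"
proof -
  have "(\<integral>\<^sup>+ \<omega>. e2ennreal (Z \<omega>) \<partial>M) = (\<integral>\<^sup>+ \<omega>. ennreal (z \<omega>) \<partial>M)"
    using Z by (intro nn_integral_cong_AE) auto
  moreover have "(\<integral>\<^sup>+ \<omega>. e2ennreal (- Z \<omega>) \<partial>M) = (\<integral>\<^sup>+ \<omega>. ennreal (- z \<omega>) \<partial>M)"
    using Z by (intro nn_integral_cong_AE) auto
  moreover have "(\<integral>\<^sup>+ \<omega>. ennreal (z \<omega>) \<partial>M) \<noteq> \<infinity>" "(\<integral>\<^sup>+ \<omega>. ennreal (- z \<omega>) \<partial>M) \<noteq> \<infinity>"
    using z by (auto simp: real_integrable_def)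
  ultimately show ?thesis
    unfolding ext_expectation_def real_lebesgue_integral_def[OF z]
    by (cases "\<integral>\<^sup>+ \<omega>. ennreal (z \<omega>) \<partial>M"; cases "\<integral>\<^sup>+ \<omega>. ennreal (- z \<omega>) \<partial>M") auto
qed

text \<open>
  On \<open>ereal\<close> the difference \<open>\<infinity> - \<infinity>\<close> is \<open>\<infinity>\<close>, so a real expectation forces both parts to be finite.
\<close>

lemma ext_expectation_finite:
  assumes Z[measurable]: "Z \<in> borel_measurable M" and r: "ext_expectation M Z = ereal r"
  shows "AE \<omega> in M. \<bar>Z \<omega>\<bar> \<noteq> \<infinity>" "integrable M (\<lambda>\<omega>. real_of_ereal (Z \<omega>))"
    "(\<integral>\<omega>. real_of_ereal (Z \<omega>) \<partial>M) = r"
proof -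
  let ?A = "\<integral>\<^sup>+ \<omega>. e2ennreal (Z \<omega>) \<partial>M" and ?B = "\<integral>\<^sup>+ \<omega>. e2ennreal (- Z \<omega>) \<partial>M"
  have "enn2ereal ?A - enn2ereal ?B = ereal r" using r by (simp add: ext_expectation_def)
  then have fin: "?A \<noteq> \<infinity>" "?B \<noteq> \<infinity>"
    by (cases ?A; cases ?B; simp)+
  have "AE \<omega> in M. e2ennreal (Z \<omega>) \<noteq> \<infinity>" "AE \<omega> in M. e2ennreal (- Z \<omega>) \<noteq> \<infinity>"
    using fin by (intro nn_integral_PInf_AE; simp)+
  then show AE: "AE \<omega> in M. \<bar>Z \<omega>\<bar> \<noteq> \<infinity>"
  proof eventually_elim
    case (elim \<omega>)
    then show ?case by (cases "Z \<omega>") auto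
  qed
  then have eq: "AE \<omega> in M. Z \<omega> = ereal (real_of_ereal (Z \<omega>))"
    by eventually_elim (auto simp: ereal_real)
  have "(\<integral>\<^sup>+ \<omega>. ennreal (real_of_ereal (Z \<omega>)) \<partial>M) = ?A"
    using eq by (intro nn_integral_cong_AE, eventually_elim) (metis e2ennreal_ereal)
  moreover have "(\<integral>\<^sup>+ \<omega>. ennreal (- real_of_ereal (Z \<omega>)) \<partial>M) = ?B"
    using eq
    by (intro nn_integral_cong_AE, eventually_elim) (metis e2ennreal_ereal uminus_ereal.simps(1))
  ultimately show int: "integrable M (\<lambda>\<omega>. real_of_ereal (Z \<omega>))"
    using fin by (auto simp: real_integrable_def)
  show "(\<integral>\<omega>. real_of_ereal (Z \<omega>) \<partial>M) = r"
    using ext_expectation_eq_integral[OF int eq] r by (metis ereal.inject)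
qed

lemma ereal_power2_nonneg: "0 \<le> (x::ereal)\<^sup>2"
  by (cases x) (auto simp: power2_eq_square)

text \<open>
  The norm of a random subdifferential may fail to be measurable. Then \<open>nn_integral\<close> is a lower integral, so
  the bound passes on exactly to measurable functions below the integrand.
\<close>

lemma nn_integral_le_ext_expectation_square:
  assumes "ext_expectation M (\<lambda>\<omega>. (Z \<omega>)\<^sup>2) \<le> ereal c"
  shows "(\<integral>\<^sup>+ \<omega>. e2ennreal ((Z \<omega>)\<^sup>2) \<partial>M) \<le> ennreal c"
proof -
  have "(\<lambda>\<omega>. e2ennreal (- (Z \<omega>)\<^sup>2)) = (\<lambda>\<omega>. 0)"
    by (auto intro!: ext e2ennreal_neg simp: ereal_power2_nonneg)
  then have "enn2ereal (\<integral>\<^sup>+ \<omega>. e2ennreal ((Z \<omega>)\<^sup>2) \<partial>M) \<le> ereal c"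
    using assms by (simp add: ext_expectation_def zero_ennreal.rep_eq)
  from e2ennreal_mono[OF this] show ?thesis by simp
qed

lemma norm_le_set_norm:
  assumes "g \<in> D"
  shows "ennreal ((norm g)\<^sup>2) \<le> e2ennreal ((set_norm D)\<^sup>2)"
proof -
  have "ereal (norm g) \<le> set_norm D"
    unfolding set_norm_def using assms by (rule SUP_upper)
  then have "ereal (norm g) * ereal (norm g) \<le> set_norm D * set_norm D"
    by (intro ereal_mult_mono) (auto intro: order_trans[of 0 "ereal (norm g)"])
  then have "ereal ((norm g)\<^sup>2) \<le> (set_norm D)\<^sup>2" by (simp add: power2_eq_square)
  from e2ennreal_mono[OF this] show ?thesis by simp
qed

text \<open>
  This is the form in which the subdifferential enters: as a function of the random parameter the left
  side is measurable, so a bound on the lower integral of the right side passes on to it.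
\<close>

lemma slope_le_set_norm:
  assumes F: "F x = ereal a" "F y = ereal b" and xy: "x \<noteq> y"
  shows "ennreal ((max 0 (b - a) / norm (y - x))\<^sup>2) \<le> e2ennreal ((set_norm (subdifferential F y))\<^sup>2)"
proof (cases "subdifferential F y = {}")
  case True
  then show ?thesis by (simp add: set_norm_empty_squared)
next
  case False
  then obtain g where g: "g \<in> subdifferential F y" by blast
  then have "F y + ereal (g \<bullet> (x - y)) \<le> F x" by (simp add: subdifferential_def)
  then have "b - a \<le> g \<bullet> (y - x)" by (simp add: F inner_diff_right)
  also have "\<dots> \<le> norm g * norm (y - x)" by (rule norm_cauchy_schwarz)
  finally have "max 0 (b - a) \<le> norm g * norm (y - x)" by simp
  then have "max 0 (b - a) / norm (y - x) \<le> norm g"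
    using xy by (simp add: pos_divide_le_eq)
  then have "ennreal ((max 0 (b - a) / norm (y - x))\<^sup>2) \<le> ennreal ((norm g)\<^sup>2)"
    by (intro ennreal_leI power_mono) auto
  also have "\<dots> \<le> e2ennreal ((set_norm (subdifferential F y))\<^sup>2)"
    using g by (rule norm_le_set_norm)
  finally show ?thesis .
qed

lemma set_norm_subdifferential_outside_domain:
  assumes F: "closed_proper_convex F" and y: "F y = \<infinity>"
  shows "e2ennreal ((set_norm (subdifferential F y))\<^sup>2) = \<infinity>"
proof -
  have "subdifferential F y = {}"
    using F y by (auto simp: subdifferential_def closed_proper_convex_def)
  then show ?thesis by (simp add: set_norm_empty_squared)
qed

section \<open>Local subgradients and density arguments\<close>

lemma ereal_convexD:
  assumes F: "convex (ereal_epigraph F)" and a: "F x = ereal a" and b: "F y = ereal b"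
    and t: "0 \<le> t" "t \<le> 1"
  shows "F ((1 - t) *\<^sub>R x + t *\<^sub>R y) \<le> ereal ((1 - t) * a + t * b)"
proof -
  have "(x, a) \<in> ereal_epigraph F" "(y, b) \<in> ereal_epigraph F"
    using a b by (auto simp: ereal_epigraph_def)
  from convexD_alt[OF F this t] show ?thesis by (simp add: ereal_epigraph_def)
qed

lemma convex_on_real_of_ereal:
  assumes F: "convex (ereal_epigraph F)" and S: "convex S" and fin: "\<And>x. x \<in> S \<Longrightarrow> \<bar>F x\<bar> \<noteq> \<infinity>"
  shows "convex_on S (\<lambda>x. real_of_ereal (F x))"
proof (rule convex_onI[OF _ S])
  fix t :: real and x y assume t: "0 < t" "t < 1" and xy: "x \<in> S" "y \<in> S"
  have "(1 - t) *\<^sub>R x + t *\<^sub>R y \<in> S" using S xy t by (auto intro: convexD)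
  from fin[OF this] show "real_of_ereal (F ((1 - t) *\<^sub>R x + t *\<^sub>R y)) \<le> (1 - t) * real_of_ereal (F x) + t * real_of_ereal (F y)"
    using ereal_convexD[OF F, of x "real_of_ereal (F x)" y "real_of_ereal (F y)" t] fin xy t
    by (cases "F ((1 - t) *\<^sub>R x + t *\<^sub>R y)") (auto simp: ereal_real)
qed

text \<open>
  A point far away is pulled along the segment towards \<open>p\<close> into \<open>U\<close>, where the inequality is known; convexity
  transports it back.
\<close>

lemma local_subgradient_imp_subgradient:
  assumes F: "convex (ereal_epigraph F)" "\<And>x. F x \<noteq> - \<infinity>" and U: "open U" "p \<in> U" and p: "F p = ereal a"
    and g: "\<And>u. u \<in> U \<Longrightarrow> F p + ereal (g \<bullet> (u - p)) \<le> F u"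
  shows "g \<in> subdifferential F p"
  unfolding subdifferential_def
proof (intro CollectI allI)
  fix y
  show "F p + ereal (g \<bullet> (y - p)) \<le> F y"
  proof (cases "F y")
    case (real b)
    have "((\<lambda>t. (1 - t) *\<^sub>R p + t *\<^sub>R y) \<longlongrightarrow> (1 - 0) *\<^sub>R p + 0 *\<^sub>R y) (at_right (0::real))"
      by (intro tendsto_intros)
    then have "eventually (\<lambda>t. (1 - t) *\<^sub>R p + t *\<^sub>R y \<in> U) (at_right (0::real))"
      using U by (intro topological_tendstoD) auto
    moreover have "eventually (\<lambda>t. t \<in> {0<..<1}) (at_right (0::real))"
      by (rule eventually_at_right_real) simp
    ultimately have "eventually (\<lambda>t. (1 - t) *\<^sub>R p + t *\<^sub>R y \<in> U \<and> t \<in> {0<..<1}) (at_right (0::real))"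
      by eventually_elim blast
    then obtain t where t: "(1 - t) *\<^sub>R p + t *\<^sub>R y \<in> U" "0 < t" "t < 1"
      using eventually_happens'[OF trivial_limit_at_right_real] by fastforce
    have "F p + ereal (g \<bullet> ((1 - t) *\<^sub>R p + t *\<^sub>R y - p)) \<le> F ((1 - t) *\<^sub>R p + t *\<^sub>R y)"
      by (rule g[OF t(1)])
    also have "\<dots> \<le> ereal ((1 - t) * a + t * b)"
      using t by (intro ereal_convexD[OF F(1) p real]) auto
    finally have "a + g \<bullet> ((1 - t) *\<^sub>R p + t *\<^sub>R y - p) \<le> (1 - t) * a + t * b"
      by (simp add: p)
    then have "t * (g \<bullet> (y - p)) \<le> t * (b - a)"
      by (simp add: inner_simps algebra_simps)
    then show ?thesis using t by (simp add: p real)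
  qed (use F(2) in auto)
qed

lemma derivative_eq_subgradient:
  fixes F :: "'a::euclidean_space \<Rightarrow> real"
  assumes F: "(F has_derivative (\<lambda>w. G \<bullet> w)) (at x)" and g: "\<And>y. F x + g \<bullet> (y - x) \<le> F y"
  shows "g = G"
proof -
  have "((\<lambda>y. F y - g \<bullet> y) has_derivative (\<lambda>w. G \<bullet> w - g \<bullet> w)) (at x)"
    by (intro derivative_intros F)
  moreover have "F x - g \<bullet> x \<le> F y - g \<bullet> y" for y
    using g[of y] by (simp add: inner_simps)
  ultimately have "(\<lambda>w. G \<bullet> w - g \<bullet> w) = (\<lambda>w. 0)"
    by (intro differential_zero_maxmin[of x UNIV "\<lambda>y. F y - g \<bullet> y"]) auto
  then have "(G - g) \<bullet> (G - g) = 0" by (simp add: inner_diff_left fun_eq_iff)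
  then show ?thesis by simp
qed

text \<open>
  A convex set and its closure have the same interior, and the closure of the hull contains \<open>U\<close>.
\<close>

lemma open_subset_hull_dense:
  fixes U :: "'a::euclidean_space set"
  assumes U: "open U" and D: "\<And>V. open V \<Longrightarrow> V \<noteq> {} \<Longrightarrow> \<exists>d\<in>D. d \<in> V"
  shows "U \<subseteq> convex hull (D \<inter> U)"
proof -
  have "U \<subseteq> closure (D \<inter> U)"
  proof
    fix u assume u: "u \<in> U"
    show "u \<in> closure (D \<inter> U)"
      unfolding closure_iff_nhds_not_empty
    proof (intro allI impI)
      fix A V assume "V \<subseteq> A" "open V" "u \<in> V"
      then have "\<exists>d\<in>D. d \<in> V \<inter> U"
        using U u by (intro D) auto
      then show "D \<inter> U \<inter> A \<noteq> {}" using \<open>V \<subseteq> A\<close> by blast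
    qed
  qed
  also have "\<dots> \<subseteq> closure (convex hull (D \<inter> U))"
    by (intro closure_mono hull_subset)
  finally have "interior U \<subseteq> interior (closure (convex hull (D \<inter> U)))"
    by (rule interior_mono)
  also have "\<dots> = interior (convex hull (D \<inter> U))"
    by (intro convex_interior_closure convex_convex_hull)
  finally show ?thesis using U interior_subset by (auto simp: interior_open)
qed

lemma le_on_open_if_le_on_dense:
  fixes f g :: "'a::euclidean_space \<Rightarrow> real"
  assumes U: "open U" and D: "\<And>V. open V \<Longrightarrow> V \<noteq> {} \<Longrightarrow> \<exists>d\<in>D. d \<in> V"
    and f: "continuous_on U f" and g: "continuous_on U g"
    and le: "\<And>d. d \<in> D \<inter> U \<Longrightarrow> f d \<le> g d" and u: "u \<in> U"
  shows "f u \<le> g u"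
proof (rule ccontr)
  assume "\<not> f u \<le> g u"
  have "open (U \<inter> (\<lambda>x. f x - g x) -` {0<..})"
    using U by (intro continuous_open_preimage continuous_on_diff f g) auto
  moreover have "u \<in> U \<inter> (\<lambda>x. f x - g x) -` {0<..}" using u \<open>\<not> f u \<le> g u\<close> by auto
  ultimately obtain d where "d \<in> D" "d \<in> U \<inter> (\<lambda>x. f x - g x) -` {0<..}" using D by blast
  with le[of d] show False by auto
qed

section \<open>Supports, independence and second moments\<close>

text \<open>
  The complement of the support is covered by countably many basic open null sets.
\<close>

lemma (in prob_space) AE_rv_support:
  fixes \<xi> :: "'a \<Rightarrow> 'b::{second_countable_topology, t2_space}"
  assumes [measurable]: "\<xi> \<in> borel_measurable M"
  shows "AE \<omega> in M. \<xi> \<omega> \<in> rv_support M \<xi>"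
proof -
  obtain B :: "'b set set" where B: "countable B" "topological_basis B"
    using ex_countable_basis by blast
  define N where "N = {b \<in> B. emeasure (distr M borel \<xi>) b = 0}"
  have "(\<Union>b\<in>N. b) \<in> null_sets (distr M borel \<xi>)"
    using B by (intro null_sets_UN') (auto simp: N_def null_sets_def topological_basis_open)
  then have "AE s in distr M borel \<xi>. s \<notin> (\<Union>b\<in>N. b)" by (rule AE_not_in)
  then have "AE \<omega> in M. \<xi> \<omega> \<notin> (\<Union>b\<in>N. b)" by (rule AE_distrD[rotated]) simp
  then show ?thesis
  proof eventually_elim
    case (elim \<omega>)
    show ?case
      unfolding rv_support_def
    proof (intro CollectI allI impI)
      fix U assume "open U" "\<xi> \<omega> \<in> U"
      then obtain b where b: "b \<in> B" "\<xi> \<omega> \<in> b" "b \<subseteq> U"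
        using topological_basisE[OF B(2)] by metis
      then have "emeasure (distr M borel \<xi>) b \<noteq> 0" using elim by (auto simp: N_def)
      moreover have "emeasure (distr M borel \<xi>) b \<le> emeasure (distr M borel \<xi>) U"
        using b \<open>open U\<close> by (intro emeasure_mono) auto
      ultimately show "0 < emeasure (distr M borel \<xi>) U"
        by (auto simp: zero_less_iff_neq_zero)
    qed
  qed
qed

lemma (in prob_space) distr_pair_indep_rvs:
  assumes X[measurable]: "X \<in> borel_measurable M" and Y[measurable]: "Y \<in> borel_measurable M"
    and indep: "indep_rvs M X Y"
  shows "distr M (borel \<Otimes>\<^sub>M borel) (\<lambda>\<omega>. (Y \<omega>, X \<omega>)) = distr M borel Y \<Otimes>\<^sub>M distr M borel X"
proof (rule pair_measure_eqI[symmetric])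
  interpret X: prob_space "distr M borel X" by (rule prob_space_distr) simp
  interpret Y: prob_space "distr M borel Y" by (rule prob_space_distr) simp
  show "sigma_finite_measure (distr M borel Y)" "sigma_finite_measure (distr M borel X)"
    by unfold_locales
  show "sets (distr M borel Y \<Otimes>\<^sub>M distr M borel X) = sets (distr M (borel \<Otimes>\<^sub>M borel) (\<lambda>\<omega>. (Y \<omega>, X \<omega>)))"
    by (simp cong: sets_pair_measure_cong)
  fix A B assume "A \<in> sets (distr M borel Y)" "B \<in> sets (distr M borel X)"
  then have AB[measurable]: "A \<in> sets borel" "B \<in> sets borel" by auto
  have "prob ((X -` B \<inter> space M) \<inter> (Y -` A \<inter> space M)) = prob (X -` B \<inter> space M) * prob (Y -` A \<inter> space M)"
    using indep[unfolded indep_rvs_def] AB by (rule_tac indep_setD) (auto intro: in_vimage_algebra)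
  moreover have "(\<lambda>\<omega>. (Y \<omega>, X \<omega>)) -` (A \<times> B) \<inter> space M = (X -` B \<inter> space M) \<inter> (Y -` A \<inter> space M)"
    by auto
  ultimately show "emeasure (distr M borel Y) A * emeasure (distr M borel X) B =
      emeasure (distr M (borel \<Otimes>\<^sub>M borel) (\<lambda>\<omega>. (Y \<omega>, X \<omega>))) (A \<times> B)"
    by (simp add: emeasure_distr emeasure_eq_measure ennreal_mult mult.commute)
qed

text \<open>
  The last bound is Jensen's inequality, obtained from the nonnegativity of the variance.
\<close>

lemma (in prob_space) first_moment_le_of_second_moment_le:
  fixes f :: "'a \<Rightarrow> 'c::{banach, second_countable_topology}"
  assumes [measurable]: "f \<in> borel_measurable M" and c: "0 \<le> c"
    and bound: "(\<integral>\<^sup>+ \<omega>. ennreal ((norm (f \<omega>))\<^sup>2) \<partial>M) \<le> ennreal (c\<^sup>2)"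
  shows "integrable M (\<lambda>\<omega>. (norm (f \<omega>))\<^sup>2)" "(\<integral>\<omega>. (norm (f \<omega>))\<^sup>2 \<partial>M) \<le> c\<^sup>2"
    "integrable M f" "(\<integral>\<omega>. norm (f \<omega>) \<partial>M) \<le> c"
proof -
  show sq: "integrable M (\<lambda>\<omega>. (norm (f \<omega>))\<^sup>2)"
    using bound by (intro integrableI_bounded) (auto intro: order_le_less_trans)
  have "ennreal (\<integral>\<omega>. (norm (f \<omega>))\<^sup>2 \<partial>M) \<le> ennreal (c\<^sup>2)"
    using bound sq by (subst nn_integral_eq_integral[symmetric]) auto
  then show le: "(\<integral>\<omega>. (norm (f \<omega>))\<^sup>2 \<partial>M) \<le> c\<^sup>2" by simp
  show int: "integrable M f"
  proof (rule Bochner_Integration.integrable_bound)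
    show "integrable M (\<lambda>\<omega>. 1 + (norm (f \<omega>))\<^sup>2)" using sq by simp
    have "norm y \<le> norm (1 + (norm y)\<^sup>2)" for y :: 'c
    proof -
      have "2 * norm y \<le> 1 + (norm y)\<^sup>2"
        using zero_le_power2[of "norm y - 1"] by (simp add: power2_eq_square algebra_simps)
      then have "norm y \<le> 1 + (norm y)\<^sup>2" using norm_ge_zero[of y] by linarith
      then show ?thesis by simp
    qed
    then show "AE \<omega> in M. norm (f \<omega>) \<le> norm (1 + (norm (f \<omega>))\<^sup>2)" by (rule AE_I2)
  qed simp
  have "0 \<le> variance (\<lambda>\<omega>. norm (f \<omega>))" by (rule variance_positive)
  also have "\<dots> = (\<integral>\<omega>. (norm (f \<omega>))\<^sup>2 \<partial>M) - (\<integral>\<omega>. norm (f \<omega>) \<partial>M)\<^sup>2"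
    using int sq by (intro variance_eq) auto
  finally have "(\<integral>\<omega>. norm (f \<omega>) \<partial>M)\<^sup>2 \<le> c\<^sup>2" using le by simp
  then show "(\<integral>\<omega>. norm (f \<omega>) \<partial>M) \<le> c" using c by (rule power2_le_imp_le)
qed

lemma (in prob_space) variance_le_second_moment:
  fixes f :: "'a \<Rightarrow> 'c::euclidean_space"
  assumes f: "integrable M f" and sq: "integrable M (\<lambda>\<omega>. (norm (f \<omega>))\<^sup>2)"
  defines "m \<equiv> \<integral>\<omega>. f \<omega> \<partial>M"
  shows "integrable M (\<lambda>\<omega>. (norm (f \<omega> - m))\<^sup>2)"
    "(\<integral>\<omega>. (norm (f \<omega> - m))\<^sup>2 \<partial>M) \<le> (\<integral>\<omega>. (norm (f \<omega>))\<^sup>2 \<partial>M)"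
proof -
  have eq: "(norm (f \<omega> - m))\<^sup>2 = (norm (f \<omega>))\<^sup>2 - 2 * (f \<omega> \<bullet> m) + (norm m)\<^sup>2" for \<omega>
    by (simp add: power2_norm_eq_inner inner_simps inner_commute)
  show "integrable M (\<lambda>\<omega>. (norm (f \<omega> - m))\<^sup>2)"
    unfolding eq using f sq by simp
  have "(\<integral>\<omega>. (norm (f \<omega> - m))\<^sup>2 \<partial>M) = (\<integral>\<omega>. (norm (f \<omega>))\<^sup>2 \<partial>M) - 2 * (m \<bullet> m) + (norm m)\<^sup>2"
    unfolding eq using f sq by (simp add: m_def prob_space)
  then show "(\<integral>\<omega>. (norm (f \<omega> - m))\<^sup>2 \<partial>M) \<le> (\<integral>\<omega>. (norm (f \<omega>))\<^sup>2 \<partial>M)"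
    by (simp add: power2_norm_eq_inner)
qed

section \<open>Reduction to a deterministic convex function\<close>

text \<open>
  The hypotheses of the smoothing result with the radius \<open>mubar\<close>, whose neighbourhood contains those of all smaller
  radii. The set \<open>X\<close> is nonempty so that finiteness of \<open>h\<close> at one of its points is available.
\<close>

locale randomized_smoothing = prob_space M
  for M :: "'w measure" +
  fixes \<xi> :: "'w \<Rightarrow> 'b::euclidean_space" and v :: "'w \<Rightarrow> 'a::euclidean_space"
    and H :: "'a \<Rightarrow> 'b \<Rightarrow> ereal" and X :: "'a set" and h :: "'a \<Rightarrow> real" and mubar L0 :: real
  assumes X_convex: "convex X" and X_nonempty: "X \<noteq> {}"
    and \<xi>_measurable [measurable]: "\<xi> \<in> borel_measurable M"
    and v_measurable [measurable]: "v \<in> borel_measurable M"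
    and distr_v: "distr M borel v = unif_ball"
    and indep: "indep_rvs M \<xi> v"
    and H_jointly_measurable: "(\<lambda>(x, s). H x s) \<in> borel_measurable (borel \<Otimes>\<^sub>M borel)"
    and H_convex: "\<And>s. s \<in> rv_support M \<xi> \<Longrightarrow> closed_proper_convex (\<lambda>x. H x s)"
    and h_eq: "\<And>x. x \<in> X \<Longrightarrow> ereal (h x) = ext_expectation M (\<lambda>\<omega>. H x (\<xi> \<omega>))"
    and mubar: "0 < mubar" and L0: "0 < L0"
    and second_moment: "\<And>x. x \<in> interior (X + cball 0 mubar) \<Longrightarrow>
       ext_expectation M (\<lambda>\<omega>. (set_norm (subdifferential (\<lambda>y. H y (\<xi> \<omega>)) x))\<^sup>2) \<le> ereal (L0\<^sup>2)"
begin

lemma H_measurable [measurable (raw)]: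
  assumes [measurable]: "f \<in> borel_measurable N" "g \<in> borel_measurable N"
  shows "(\<lambda>\<omega>. H (f \<omega>) (g \<omega>)) \<in> borel_measurable N"
  using measurable_compose[OF _ H_jointly_measurable, of "\<lambda>\<omega>. (f \<omega>, g \<omega>)" N] by simp

definition U :: "'a set" where "U = interior (X + cball 0 mubar)"

definition H_real :: "'a \<Rightarrow> 'b \<Rightarrow> real" where "H_real y s = real_of_ereal (H y s)"

lemma H_real_measurable [measurable (raw)]:
  assumes [measurable]: "f \<in> borel_measurable N" "g \<in> borel_measurable N"
  shows "(\<lambda>\<omega>. H_real (f \<omega>) (g \<omega>)) \<in> borel_measurable N"
  unfolding H_real_def by measurable

text \<open>
  The expectation as a function on \<open>U\<close>, where it extends \<open>h\<close>.
\<close>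

definition mean_H :: "'a \<Rightarrow> real" where "mean_H y = (\<integral>\<omega>. H_real y (\<xi> \<omega>) \<partial>M)"

lemma open_U: "open U" by (simp add: U_def)

lemma convex_U: "convex U"
  unfolding U_def by (intro convex_interior convex_set_plus X_convex convex_cball)

lemma perturbed_in_U:
  assumes "x \<in> X" "\<bar>\<mu>\<bar> \<le> mubar" "norm z < 1"
  shows "x + \<mu> *\<^sub>R z \<in> U"
proof -
  have "ball x mubar \<subseteq> X + cball 0 mubar"
  proof
    fix y assume "y \<in> ball x mubar"
    then have "y - x \<in> cball 0 mubar" by (simp add: dist_norm norm_minus_commute)
    then have "x + (y - x) \<in> X + cball 0 mubar" using assms(1) by (intro set_plus_intro)
    then show "y \<in> X + cball 0 mubar" by simp
  qed
  then have "ball x mubar \<subseteq> U" unfolding U_def by (intro interior_maximal) auto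
  moreover have "\<bar>\<mu>\<bar> * norm z < mubar"
    using assms mubar by (cases "\<mu> = 0") (auto intro: order_less_le_trans[of _ "\<bar>\<mu>\<bar>"])
  then have "x + \<mu> *\<^sub>R z \<in> ball x mubar" by (simp add: dist_norm)
  ultimately show ?thesis by blast
qed

lemma X_subset_U: "X \<subseteq> U"
  using perturbed_in_U[of _ 0 0] mubar by auto

lemma subdifferential_moment:
  "y \<in> U \<Longrightarrow> (\<integral>\<^sup>+ \<omega>. e2ennreal ((set_norm (subdifferential (\<lambda>u. H u (\<xi> \<omega>)) y))\<^sup>2) \<partial>M) \<le> ennreal (L0\<^sup>2)"
  unfolding U_def by (rule nn_integral_le_ext_expectation_square[OF second_moment])

lemma AE_closed_proper_convex: "AE \<omega> in M. closed_proper_convex (\<lambda>x. H x (\<xi> \<omega>))"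
  using AE_rv_support[OF \<xi>_measurable] by eventually_elim (rule H_convex)

text \<open>
  Where the convex function is infinite its subdifferential is empty and the squared norm infinite, which a
  finite second moment rules out almost surely.
\<close>

lemma AE_H_finite:
  assumes y: "y \<in> U"
  shows "AE \<omega> in M. \<bar>H y (\<xi> \<omega>)\<bar> \<noteq> \<infinity>"
proof -
  let ?Z = "\<lambda>\<omega>. if H y (\<xi> \<omega>) = \<infinity> then \<infinity> else 0 :: ennreal"
  have "(\<integral>\<^sup>+ \<omega>. ?Z \<omega> \<partial>M) \<le> (\<integral>\<^sup>+ \<omega>. e2ennreal ((set_norm (subdifferential (\<lambda>u. H u (\<xi> \<omega>)) y))\<^sup>2) \<partial>M)"
    using AE_closed_proper_convex
    by (intro nn_integral_mono_AE, eventually_elim) (simp add: set_norm_subdifferential_outside_domain)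
  also have "\<dots> \<le> ennreal (L0\<^sup>2)" by (rule subdifferential_moment[OF y])
  finally have "(\<integral>\<^sup>+ \<omega>. ?Z \<omega> \<partial>M) \<noteq> \<infinity>" by (auto simp: top_unique)
  then have "AE \<omega> in M. ?Z \<omega> \<noteq> \<infinity>" by (intro nn_integral_PInf_AE) auto
  then show ?thesis
    using AE_closed_proper_convex
    by eventually_elim (auto simp: closed_proper_convex_def split: if_splits)
qed

text \<open>
  The exceptional null sets of the single points are collected over a countable dense subset, and convexity of the
  effective domain spreads finiteness from there to all of \<open>U\<close>.
\<close>

lemma AE_H_finite_on_U: "AE \<omega> in M. \<forall>u\<in>U. \<bar>H u (\<xi> \<omega>)\<bar> \<noteq> \<infinity>"
proof -
  obtain D :: "'a set" where D: "countable D" "\<And>V. open V \<Longrightarrow> V \<noteq> {} \<Longrightarrow> \<exists>d\<in>D. d \<in> V"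
    using countable_dense_setE by blast
  have "AE \<omega> in M. \<forall>d\<in>D \<inter> U. \<bar>H d (\<xi> \<omega>)\<bar> \<noteq> \<infinity>"
    using D(1) AE_H_finite by (subst AE_ball_countable) (auto intro: countable_Int1)
  then show ?thesis
    using AE_closed_proper_convex
  proof eventually_elim
    case (elim \<omega>)
    let ?F = "\<lambda>x. H x (\<xi> \<omega>)"
    have F: "convex (ereal_epigraph ?F)" "\<And>x. ?F x \<noteq> - \<infinity>"
      using elim(2) by (auto simp: closed_proper_convex_def)
    have "convex {x. ?F x < \<infinity>}"
    proof (rule convexI)
      fix x y :: 'a and s t :: real assume xy: "x \<in> {x. ?F x < \<infinity>}" "y \<in> {x. ?F x < \<infinity>}" and st: "0 \<le> s" "0 \<le> t" "s + t = 1"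
      obtain a b where "?F x = ereal a" "?F y = ereal b"
        using xy F(2)[of x] F(2)[of y] by (cases "?F x"; cases "?F y") auto
      from ereal_convexD[OF F(1) this, of t] st show "s *\<^sub>R x + t *\<^sub>R y \<in> {x. ?F x < \<infinity>}"
        by (auto simp: eq_diff_eq[symmetric] intro: order_le_less_trans)
    qed
    then have "convex hull (D \<inter> U) \<subseteq> {x. ?F x < \<infinity>}"
    proof (intro hull_minimal subsetI CollectI)
      fix d assume "d \<in> D \<inter> U"
      then have "\<bar>?F d\<bar> \<noteq> \<infinity>" by (rule bspec[OF elim(1)])
      then show "?F d < \<infinity>" by (cases "?F d") auto
    qed
    moreover have "U \<subseteq> convex hull (D \<inter> U)"
      using open_U D(2) by (rule open_subset_hull_dense)
    ultimately have "?F u < \<infinity>" if "u \<in> U" for u using that by blast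
    then show ?case using F(2) by (intro ballI ereal_infinity_cases) auto
  qed
qed

lemma AE_convex_on_U: "AE \<omega> in M. convex_on U (\<lambda>y. H_real y (\<xi> \<omega>))"
  using AE_closed_proper_convex AE_H_finite_on_U
proof eventually_elim
  case (elim \<omega>)
  then show ?case
    unfolding H_real_def by (intro convex_on_real_of_ereal convex_U) (auto simp: closed_proper_convex_def)
qed

lemma increment_second_moment:
  assumes x: "x \<in> U" and y: "y \<in> U"
  shows "(\<integral>\<^sup>+ \<omega>. ennreal ((norm (max 0 (H_real y (\<xi> \<omega>) - H_real x (\<xi> \<omega>))))\<^sup>2) \<partial>M) \<le> ennreal ((L0 * norm (y - x))\<^sup>2)"
proof (cases "x = y")
  case False
  let ?n = "norm (y - x)"
  have n: "?n > 0" using False by simp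
  have "(\<integral>\<^sup>+ \<omega>. ennreal ((max 0 (H_real y (\<xi> \<omega>) - H_real x (\<xi> \<omega>)) / ?n)\<^sup>2) \<partial>M) \<le>
     (\<integral>\<^sup>+ \<omega>. e2ennreal ((set_norm (subdifferential (\<lambda>u. H u (\<xi> \<omega>)) y))\<^sup>2) \<partial>M)"
    using AE_H_finite[OF x] AE_H_finite[OF y]
  proof (intro nn_integral_mono_AE, eventually_elim)
    case (elim \<omega>)
    show ?case
      using elim False by (intro slope_le_set_norm[where F="\<lambda>u. H u (\<xi> \<omega>)"]) (auto simp: H_real_def ereal_real)
  qed
  also have "\<dots> \<le> ennreal (L0\<^sup>2)" by (rule subdifferential_moment[OF y])
  finally have le: "(\<integral>\<^sup>+ \<omega>. ennreal ((max 0 (H_real y (\<xi> \<omega>) - H_real x (\<xi> \<omega>)) / ?n)\<^sup>2) \<partial>M) \<le> ennreal (L0\<^sup>2)" .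
  have "(\<integral>\<^sup>+ \<omega>. ennreal ((norm (max 0 (H_real y (\<xi> \<omega>) - H_real x (\<xi> \<omega>))))\<^sup>2) \<partial>M) =
      (\<integral>\<^sup>+ \<omega>. ennreal (?n\<^sup>2) * ennreal ((max 0 (H_real y (\<xi> \<omega>) - H_real x (\<xi> \<omega>)) / ?n)\<^sup>2) \<partial>M)"
    using n by (intro nn_integral_cong) (simp add: power_divide flip: ennreal_mult)
  also have "\<dots> = ennreal (?n\<^sup>2) * (\<integral>\<^sup>+ \<omega>. ennreal ((max 0 (H_real y (\<xi> \<omega>) - H_real x (\<xi> \<omega>)) / ?n)\<^sup>2) \<partial>M)"
    by (rule nn_integral_cmult) measurable
  also have "\<dots> \<le> ennreal (?n\<^sup>2) * ennreal (L0\<^sup>2)" using le by (rule mult_left_mono) simp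
  also have "\<dots> = ennreal ((L0 * ?n)\<^sup>2)"
    by (simp add: power_mult_distrib mult.commute flip: ennreal_mult)
  finally show ?thesis .
qed simp

text \<open>
  Only the positive part of an increment is controlled directly; the negative part is the positive part of the
  opposite increment. The expected increment itself is at most its positive part, hence no factor two there.
\<close>

lemma increment_integrable:
  assumes x: "x \<in> U" and y: "y \<in> U"
  shows "integrable M (\<lambda>\<omega>. H_real y (\<xi> \<omega>) - H_real x (\<xi> \<omega>))"
    and "(\<integral>\<omega>. H_real y (\<xi> \<omega>) - H_real x (\<xi> \<omega>) \<partial>M) \<le> L0 * norm (y - x)"
    and "(\<integral>\<omega>. \<bar>H_real y (\<xi> \<omega>) - H_real x (\<xi> \<omega>)\<bar> \<partial>M) \<le> 2 * L0 * norm (y - x)"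
proof -
  let ?D = "\<lambda>y x \<omega>. max 0 (H_real y (\<xi> \<omega>) - H_real x (\<xi> \<omega>))"
  have D: "integrable M (?D y x)" "(\<integral>\<omega>. ?D y x \<omega> \<partial>M) \<le> L0 * norm (y - x)" if "x \<in> U" "y \<in> U" for x y
    using first_moment_le_of_second_moment_le(3,4)[OF _ _ increment_second_moment[OF that]] L0 by auto
  have d1: "(\<lambda>\<omega>. H_real y (\<xi> \<omega>) - H_real x (\<xi> \<omega>)) = (\<lambda>\<omega>. ?D y x \<omega> - ?D x y \<omega>)"
    by (auto simp: fun_eq_iff max_def)
  have d2: "\<bar>H_real y (\<xi> \<omega>) - H_real x (\<xi> \<omega>)\<bar> = ?D y x \<omega> + ?D x y \<omega>" for \<omega>
    by (auto simp: max_def)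
  show int: "integrable M (\<lambda>\<omega>. H_real y (\<xi> \<omega>) - H_real x (\<xi> \<omega>))"
    by (subst d1) (intro Bochner_Integration.integrable_diff D x y)
  have "(\<integral>\<omega>. H_real y (\<xi> \<omega>) - H_real x (\<xi> \<omega>) \<partial>M) \<le> (\<integral>\<omega>. ?D y x \<omega> \<partial>M)"
    using int D(1)[OF x y] by (intro integral_mono) auto
  then show "(\<integral>\<omega>. H_real y (\<xi> \<omega>) - H_real x (\<xi> \<omega>) \<partial>M) \<le> L0 * norm (y - x)"
    using D(2)[OF x y] by linarith
  have "(\<integral>\<omega>. \<bar>H_real y (\<xi> \<omega>) - H_real x (\<xi> \<omega>)\<bar> \<partial>M) = (\<integral>\<omega>. ?D y x \<omega> \<partial>M) + (\<integral>\<omega>. ?D x y \<omega> \<partial>M)"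
    unfolding d2 by (rule Bochner_Integration.integral_add[OF D(1)[OF x y] D(1)[OF y x]])
  then show "(\<integral>\<omega>. \<bar>H_real y (\<xi> \<omega>) - H_real x (\<xi> \<omega>)\<bar> \<partial>M) \<le> 2 * L0 * norm (y - x)"
    using D(2)[OF x y] D(2)[OF y x] by (simp add: norm_minus_commute)
qed

lemma expectation_on_X:
  assumes "x \<in> X"
  shows "integrable M (\<lambda>\<omega>. H_real x (\<xi> \<omega>))" "mean_H x = h x"
  using ext_expectation_finite[OF _ h_eq[OF assms, symmetric]] unfolding mean_H_def H_real_def by auto

text \<open>
  Integrability at a point of \<open>X\<close> is part of the hypothesis on \<open>h\<close>, and increments are integrable.
\<close>

lemma H_real_integrable:
  assumes y: "y \<in> U"
  shows "integrable M (\<lambda>\<omega>. H_real y (\<xi> \<omega>))"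
proof -
  obtain x where x: "x \<in> X" using X_nonempty by blast
  have "integrable M (\<lambda>\<omega>. (H_real y (\<xi> \<omega>) - H_real x (\<xi> \<omega>)) + H_real x (\<xi> \<omega>))"
    using x X_subset_U y by (intro Bochner_Integration.integrable_add increment_integrable expectation_on_X) auto
  then show ?thesis by simp
qed

lemma mean_H_lipschitz: "L0-lipschitz_on U mean_H"
proof (rule lipschitz_onI)
  have *: "mean_H y - mean_H x \<le> L0 * norm (y - x)" if "x \<in> U" "y \<in> U" for x y
    using increment_integrable(2)[OF that] H_real_integrable that
    by (simp add: mean_H_def Bochner_Integration.integral_diff)
  show "dist (mean_H x) (mean_H y) \<le> L0 * dist x y" if "x \<in> U" "y \<in> U" for x y
    using *[of x y] *[of y x] that by (simp add: dist_norm norm_minus_commute)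
qed (use L0 in simp)

lemma mean_H_convex: "convex_on U mean_H"
proof (rule convex_onI[OF _ convex_U])
  fix t :: real and x y assume t: "0 < t" "t < 1" and xy: "x \<in> U" "y \<in> U"
  have z: "(1 - t) *\<^sub>R x + t *\<^sub>R y \<in> U" using convex_U xy t by (auto intro: convexD)
  have "mean_H ((1 - t) *\<^sub>R x + t *\<^sub>R y) \<le> (\<integral>\<omega>. (1 - t) * H_real x (\<xi> \<omega>) + t * H_real y (\<xi> \<omega>) \<partial>M)"
    unfolding mean_H_def
  proof (intro integral_mono_AE Bochner_Integration.integrable_add integrable_mult_right H_real_integrable xy z)
    show "AE \<omega> in M. H_real ((1 - t) *\<^sub>R x + t *\<^sub>R y) (\<xi> \<omega>) \<le> (1 - t) * H_real x (\<xi> \<omega>) + t * H_real y (\<xi> \<omega>)"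
      using AE_convex_on_U by eventually_elim (rule convex_onD; use t xy in simp)
  qed
  also have "\<dots> = (1 - t) * mean_H x + t * mean_H y"
    unfolding mean_H_def using H_real_integrable[OF xy(1)] H_real_integrable[OF xy(2)] by simp
  finally show "mean_H ((1 - t) *\<^sub>R x + t *\<^sub>R y) \<le> (1 - t) * mean_H x + t * mean_H y" .
qed

section \<open>Fubini for the joint law\<close>

definition law_xi :: "'b measure" where "law_xi = distr M borel \<xi>"

text \<open>
  The perturbation comes first, so that iterated integrals average over \<open>\<xi>\<close> at a fixed perturbation first.
\<close>

definition joint_law :: "('a \<times> 'b) measure" where "joint_law = unif_ball \<Otimes>\<^sub>M law_xi"

lemma sets_law_xi [simp, measurable_cong]: "sets law_xi = sets borel" by (simp add: law_xi_def)

lemma prob_space_law_xi: "prob_space law_xi"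
  unfolding law_xi_def by (rule prob_space_distr) simp

lemma pair_sigma_finite_joint_law: "pair_sigma_finite (unif_ball :: 'a measure) law_xi"
  by (intro pair_sigma_finite.intro prob_space_imp_sigma_finite prob_space_unif_ball prob_space_law_xi)

lemma sets_joint_law [measurable_cong]: "sets joint_law = sets (borel \<Otimes>\<^sub>M borel)"
  unfolding joint_law_def by (rule sets_pair_measure_cong) simp_all

lemma distr_joint_law: "distr M (borel \<Otimes>\<^sub>M borel) (\<lambda>\<omega>. (v \<omega>, \<xi> \<omega>)) = joint_law"
  unfolding joint_law_def law_xi_def using distr_pair_indep_rvs[OF \<xi>_measurable v_measurable indep] by (simp add: distr_v)

lemma integral_joint_law:
  fixes f :: "'a \<times> 'b \<Rightarrow> 'c::{banach, second_countable_topology}"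
  assumes [measurable]: "f \<in> borel_measurable (borel \<Otimes>\<^sub>M borel)"
  shows "(\<integral>p. f p \<partial>joint_law) = (\<integral>\<omega>. f (v \<omega>, \<xi> \<omega>) \<partial>M)"
    and "integrable joint_law f \<longleftrightarrow> integrable M (\<lambda>\<omega>. f (v \<omega>, \<xi> \<omega>))"
  unfolding distr_joint_law[symmetric] by (simp_all add: integral_distr integrable_distr_eq)

lemma nn_integral_joint_law:
  assumes [measurable]: "f \<in> borel_measurable (borel \<Otimes>\<^sub>M borel)"
  shows "(\<integral>\<^sup>+ p. f p \<partial>joint_law) = (\<integral>\<^sup>+ \<omega>. f (v \<omega>, \<xi> \<omega>) \<partial>M)"
  unfolding distr_joint_law[symmetric] by (simp add: nn_integral_distr)

lemma integral_law_xi: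
  fixes f :: "'b \<Rightarrow> 'c::{banach, second_countable_topology}"
  assumes [measurable]: "f \<in> borel_measurable borel"
  shows "(\<integral>s. f s \<partial>law_xi) = (\<integral>\<omega>. f (\<xi> \<omega>) \<partial>M)"
    and "integrable law_xi f \<longleftrightarrow> integrable M (\<lambda>\<omega>. f (\<xi> \<omega>))"
  unfolding law_xi_def by (simp_all add: integral_distr integrable_distr_eq)

lemma AE_v_norm: "AE \<omega> in M. norm (v \<omega>) < 1"
proof -
  have "AE z in distr M borel v. norm z < 1" unfolding distr_v by (rule AE_unif_ball)
  then show ?thesis by (rule AE_distrD[rotated]) simp
qed

text \<open>
  Fubini for null sets, stated so that afterwards \<open>\<xi>\<close> is again a random variable on \<open>M\<close> and properties of
  \<open>\<xi> \<omega>\<close> that are known only almost surely on \<open>M\<close> can be combined with it.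
\<close>

lemma AE_slices:
  assumes Q: "AE \<omega> in M. Q (v \<omega>) (\<xi> \<omega>)" and [measurable]: "Measurable.pred (borel \<Otimes>\<^sub>M borel) (\<lambda>p. Q (fst p) (snd p))"
  shows "AE z in unif_ball. AE \<omega> in M. Q z (\<xi> \<omega>)"
proof -
  interpret pair_sigma_finite "unif_ball :: 'a measure" law_xi by (rule pair_sigma_finite_joint_law)
  have "AE p in joint_law. Q (fst p) (snd p)"
    unfolding distr_joint_law[symmetric] using Q by (subst AE_distr_iff) auto
  then have "AE z in unif_ball. AE s in law_xi. Q z s"
    unfolding joint_law_def by (auto dest: AE_pair)
  then show ?thesis
  proof eventually_elim
    case (elim z)
    then show ?case unfolding law_xi_def by (rule AE_distrD[rotated]) simp
  qed
qed

text \<open>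
  Joint integrability follows from Fubini applied to the increment from \<open>x\<close>, whose expected absolute value is bounded
  uniformly in the perturbation.
\<close>

lemma smoothed_eq_average:
  assumes x: "x \<in> X" and \<mu>: "\<bar>\<mu>\<bar> \<le> mubar"
  shows "smoothed M \<xi> v H x \<mu> = ereal (\<integral>z. mean_H (x + \<mu> *\<^sub>R z) \<partial>unif_ball)"
proof -
  interpret pair_sigma_finite "unif_ball :: 'a measure" law_xi by (rule pair_sigma_finite_joint_law)
  interpret B: prob_space "unif_ball :: 'a measure" by (rule prob_space_unif_ball)
  define K where "K = (\<lambda>p. H_real (x + \<mu> *\<^sub>R fst p) (snd p))"
  define K' where "K' = (\<lambda>p::'a \<times> 'b. H_real (x + \<mu> *\<^sub>R fst p) (snd p) - H_real x (snd p))"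
  have Km [measurable]: "K \<in> borel_measurable (borel \<Otimes>\<^sub>M borel)" "K' \<in> borel_measurable (borel \<Otimes>\<^sub>M borel)"
    unfolding K_def K'_def by measurable
  have xU: "x \<in> U" using x X_subset_U by blast
  have inU: "AE z in unif_ball. x + \<mu> *\<^sub>R z \<in> U"
    using AE_unif_ball by eventually_elim (rule perturbed_in_U[OF x \<mu>])
  have "integrable joint_law K'"
    unfolding joint_law_def
  proof (rule Fubini_integrable)
    show "K' \<in> borel_measurable (unif_ball \<Otimes>\<^sub>M law_xi)"
      using Km(2) by (simp cong: measurable_cong_sets sets_pair_measure_cong)
    show "AE z in unif_ball. integrable law_xi (\<lambda>s. K' (z, s))"
      using inU
    proof eventually_elim
      case (elim z)
      show ?case
        unfolding K'_def using increment_integrable(1)[OF xU elim] by (subst integral_law_xi(2)) auto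
    qed
    show "integrable unif_ball (\<lambda>z. \<integral>s. norm (K' (z, s)) \<partial>law_xi)"
    proof (rule B.integrable_const_bound[where B = "2 * L0 * mubar"])
      show "AE z in unif_ball. norm (\<integral>s. norm (K' (z, s)) \<partial>law_xi) \<le> 2 * L0 * mubar"
        using inU AE_unif_ball
      proof eventually_elim
        case (elim z)
        have "norm (\<integral>s. norm (K' (z, s)) \<partial>law_xi) = (\<integral>s. norm (K' (z, s)) \<partial>law_xi)"
          by (simp add: integral_nonneg_AE)
        also have "\<dots> = (\<integral>\<omega>. \<bar>H_real (x + \<mu> *\<^sub>R z) (\<xi> \<omega>) - H_real x (\<xi> \<omega>)\<bar> \<partial>M)"
          by (subst integral_law_xi(1)) (auto simp: K'_def)
        also have "\<dots> \<le> 2 * L0 * norm (\<mu> *\<^sub>R z)"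
          using increment_integrable(3)[OF xU elim(1)] by simp
        also have "\<dots> \<le> 2 * L0 * mubar"
          using elim(2) \<mu> L0 mubar by (intro mult_left_mono) (auto simp: intro: order_trans[OF mult_mono[of _ mubar _ 1]])
        finally show ?case .
      qed
      show "(\<lambda>z. \<integral>s. norm (K' (z, s)) \<partial>law_xi) \<in> borel_measurable unif_ball"
        using Km(2) by measurable
    qed
  qed
  then have "integrable M (\<lambda>\<omega>. K' (v \<omega>, \<xi> \<omega>))"
    using integral_joint_law(2)[OF Km(2)] by simp
  from Bochner_Integration.integrable_add[OF this expectation_on_X(1)[OF x]]
  have intM: "integrable M (\<lambda>\<omega>. K (v \<omega>, \<xi> \<omega>))" by (simp add: K_def K'_def)
  then have intN: "integrable (unif_ball \<Otimes>\<^sub>M law_xi) K"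
    using integral_joint_law(2)[OF Km(1)] by (simp add: joint_law_def)
  have "AE \<omega> in M. H (x + \<mu> *\<^sub>R v \<omega>) (\<xi> \<omega>) = ereal (K (v \<omega>, \<xi> \<omega>))"
    using AE_v_norm AE_H_finite_on_U
  proof eventually_elim
    case (elim \<omega>)
    then show ?case
      using perturbed_in_U[OF x \<mu> elim(1)] by (auto simp: K_def H_real_def ereal_real)
  qed
  then have "smoothed M \<xi> v H x \<mu> = ereal (\<integral>\<omega>. K (v \<omega>, \<xi> \<omega>) \<partial>M)"
    unfolding smoothed_def by (rule ext_expectation_eq_integral[OF intM])
  also have "(\<integral>\<omega>. K (v \<omega>, \<xi> \<omega>) \<partial>M) = (\<integral>z. \<integral>s. K (z, s) \<partial>law_xi \<partial>unif_ball)"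
    using integral_joint_law(1)[OF Km(1)] integral_fst'[OF intN] by (simp add: joint_law_def)
  also have "(\<lambda>z. \<integral>s. K (z, s) \<partial>law_xi) = (\<lambda>z. mean_H (x + \<mu> *\<^sub>R z))"
    by (auto simp: K_def mean_H_def fun_eq_iff intro!: integral_law_xi(1))
  finally show ?thesis .
qed

section \<open>Measurable selections of subgradients\<close>

text \<open>
  Membership of \<open>\<gamma>\<close> in a subdifferential need not be a measurable condition, so it cannot be passed
  directly to the product space. It is replaced by the subgradient inequalities at countably many dense points of \<open>U\<close>;
  these are measurable, Fubini gives them for almost every fixed perturbation \<open>z\<close>, and continuity of convex functions
  on \<open>U\<close> turns them back into membership in the subdifferential at \<open>x + \<mu> z\<close>. The moment bound at this single point
  then applies. Averaging the same inequalities over \<open>\<xi>\<close> makes the mean of \<open>\<gamma>\<close> at fixed \<open>z\<close> a subgradient of \<open>F\<close>,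
  and averaging over \<open>z\<close> makes the full mean a subgradient of the ball average.
\<close>

lemma selection_moments:
  fixes \<gamma> :: "'b \<times> 'a \<Rightarrow> 'a"
  assumes x: "x \<in> X" and \<mu>: "\<bar>\<mu>\<bar> \<le> mubar"
    and \<gamma>m [measurable]: "\<gamma> \<in> borel_measurable (borel \<Otimes>\<^sub>M borel)"
    and \<gamma>: "AE \<omega> in M. \<gamma> (\<xi> \<omega>, v \<omega>) \<in> subdifferential (\<lambda>y. H y (\<xi> \<omega>)) (x + \<mu> *\<^sub>R v \<omega>)"
    and F: "convex_on UNIV F" "L0-lipschitz_on UNIV F" "\<And>u. u \<in> U \<Longrightarrow> F u = mean_H u"
  shows "(\<integral>\<^sup>+ \<omega>. ennreal ((norm (\<gamma> (\<xi> \<omega>, v \<omega>)))\<^sup>2) \<partial>M) \<le> ennreal (L0\<^sup>2)"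
    and "ball_average F \<mu> x + (\<integral>\<omega>. \<gamma> (\<xi> \<omega>, v \<omega>) \<partial>M) \<bullet> w \<le> ball_average F \<mu> (x + w)"
proof -
  interpret pair_sigma_finite "unif_ball :: 'a measure" law_xi by (rule pair_sigma_finite_joint_law)
  interpret B: prob_space "unif_ball :: 'a measure" by (rule prob_space_unif_ball)
  obtain D :: "'a set" where D: "countable D" "\<And>V. open V \<Longrightarrow> V \<noteq> {} \<Longrightarrow> \<exists>d\<in>D. d \<in> V"
    using countable_dense_setE by blast
  define p where "p z = x + \<mu> *\<^sub>R z" for z
  have inU: "p z \<in> U" if "norm z < 1" for z
    unfolding p_def by (rule perturbed_in_U[OF x \<mu> that])
  have "AE z in unif_ball. AE \<omega> in M. H_real (p z) (\<xi> \<omega>) + \<gamma> (\<xi> \<omega>, z) \<bullet> (q - p z) \<le> H_real q (\<xi> \<omega>)"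
    if q: "q \<in> U" for q
  proof (rule AE_slices)
    show "AE \<omega> in M. H_real (p (v \<omega>)) (\<xi> \<omega>) + \<gamma> (\<xi> \<omega>, v \<omega>) \<bullet> (q - p (v \<omega>)) \<le> H_real q (\<xi> \<omega>)"
      using \<gamma> AE_v_norm AE_H_finite_on_U
    proof eventually_elim
      case (elim \<omega>)
      have "\<bar>H q (\<xi> \<omega>)\<bar> \<noteq> \<infinity>" "\<bar>H (p (v \<omega>)) (\<xi> \<omega>)\<bar> \<noteq> \<infinity>"
        using bspec[OF elim(3) q] bspec[OF elim(3) inU[OF elim(2)]] by simp_all
      moreover have "H (p (v \<omega>)) (\<xi> \<omega>) + ereal (\<gamma> (\<xi> \<omega>, v \<omega>) \<bullet> (q - p (v \<omega>))) \<le> H q (\<xi> \<omega>)"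
        using elim(1) by (simp add: subdifferential_def p_def)
      ultimately show ?case
        by (cases "H q (\<xi> \<omega>)"; cases "H (p (v \<omega>)) (\<xi> \<omega>)") (auto simp: H_real_def)
    qed
  qed (unfold p_def, measurable)
  then have "AE z in unif_ball. \<forall>q\<in>D \<inter> U. AE \<omega> in M. H_real (p z) (\<xi> \<omega>) + \<gamma> (\<xi> \<omega>, z) \<bullet> (q - p z) \<le> H_real q (\<xi> \<omega>)"
    using D(1) by (subst AE_ball_countable) (auto intro: countable_Int1)
  then have "AE z in unif_ball. AE \<omega> in M. \<forall>q\<in>D \<inter> U. H_real (p z) (\<xi> \<omega>) + \<gamma> (\<xi> \<omega>, z) \<bullet> (q - p z) \<le> H_real q (\<xi> \<omega>)"
    using D(1) by (subst AE_ball_countable) (auto intro: countable_Int1)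
  then have slice: "AE z in unif_ball. norm z < 1 \<and>
      (AE \<omega> in M. \<forall>q\<in>D \<inter> U. H_real (p z) (\<xi> \<omega>) + \<gamma> (\<xi> \<omega>, z) \<bullet> (q - p z) \<le> H_real q (\<xi> \<omega>))"
    using AE_unif_ball by eventually_elim blast
  have moment: "(\<integral>\<^sup>+ \<omega>. ennreal ((norm (\<gamma> (\<xi> \<omega>, z)))\<^sup>2) \<partial>M) \<le> ennreal (L0\<^sup>2)"
    if z: "norm z < 1" and
      ae: "AE \<omega> in M. \<forall>q\<in>D \<inter> U. H_real (p z) (\<xi> \<omega>) + \<gamma> (\<xi> \<omega>, z) \<bullet> (q - p z) \<le> H_real q (\<xi> \<omega>)" for z
  proof -
    note pz = inU[OF z]
    have "AE \<omega> in M. ennreal ((norm (\<gamma> (\<xi> \<omega>, z)))\<^sup>2) \<le> e2ennreal ((set_norm (subdifferential (\<lambda>y. H y (\<xi> \<omega>)) (p z)))\<^sup>2)"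
      using ae AE_closed_proper_convex AE_H_finite_on_U AE_convex_on_U
    proof eventually_elim
      case (elim \<omega>)
      have cont: "continuous_on U (\<lambda>u. H_real u (\<xi> \<omega>))"
        using open_U elim(4) by (rule convex_on_continuous)
      have fin: "H u (\<xi> \<omega>) = ereal (H_real u (\<xi> \<omega>))" if "u \<in> U" for u
        using elim(3) that by (auto simp: H_real_def ereal_real)
      have "\<gamma> (\<xi> \<omega>, z) \<in> subdifferential (\<lambda>y. H y (\<xi> \<omega>)) (p z)"
      proof (rule local_subgradient_imp_subgradient[where F = "\<lambda>y. H y (\<xi> \<omega>)", OF _ _ open_U pz fin[OF pz]])
        show "convex (ereal_epigraph (\<lambda>y. H y (\<xi> \<omega>)))" "H y (\<xi> \<omega>) \<noteq> - \<infinity>" for y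
          using elim(2) by (auto simp: closed_proper_convex_def)
        fix u assume u: "u \<in> U"
        have "H_real (p z) (\<xi> \<omega>) + \<gamma> (\<xi> \<omega>, z) \<bullet> (u - p z) \<le> H_real u (\<xi> \<omega>)"
        proof (rule le_on_open_if_le_on_dense[OF open_U D(2) _ cont _ u])
          show "continuous_on U (\<lambda>u. H_real (p z) (\<xi> \<omega>) + \<gamma> (\<xi> \<omega>, z) \<bullet> (u - p z))"
            by (intro continuous_intros)
        qed (use elim(1) in auto)
        then show "H (p z) (\<xi> \<omega>) + ereal (\<gamma> (\<xi> \<omega>, z) \<bullet> (u - p z)) \<le> H u (\<xi> \<omega>)"
          by (simp add: fin[OF pz] fin[OF u])
      qed
      then show ?case by (rule norm_le_set_norm)
    qed
    then have "(\<integral>\<^sup>+ \<omega>. ennreal ((norm (\<gamma> (\<xi> \<omega>, z)))\<^sup>2) \<partial>M) \<le>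
        (\<integral>\<^sup>+ \<omega>. e2ennreal ((set_norm (subdifferential (\<lambda>y. H y (\<xi> \<omega>)) (p z)))\<^sup>2) \<partial>M)"
      by (rule nn_integral_mono_AE)
    also have "\<dots> \<le> ennreal (L0\<^sup>2)" by (rule subdifferential_moment[OF pz])
    finally show ?thesis .
  qed
  define \<gamma>' where "\<gamma>' = (\<lambda>q. \<gamma> (snd q, fst q))"
  have \<gamma>'m [measurable]: "\<gamma>' \<in> borel_measurable (borel \<Otimes>\<^sub>M borel)"
    unfolding \<gamma>'_def by measurable
  have "(\<integral>\<^sup>+ \<omega>. ennreal ((norm (\<gamma> (\<xi> \<omega>, v \<omega>)))\<^sup>2) \<partial>M) = (\<integral>\<^sup>+ q. ennreal ((norm (\<gamma>' q))\<^sup>2) \<partial>joint_law)"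
    by (subst nn_integral_joint_law) (auto simp: \<gamma>'_def)
  also have "\<dots> = (\<integral>\<^sup>+ z. \<integral>\<^sup>+ s. ennreal ((norm (\<gamma>' (z, s)))\<^sup>2) \<partial>law_xi \<partial>unif_ball)"
    unfolding joint_law_def by (rule M2.nn_integral_fst[symmetric]) measurable
  also have "\<dots> \<le> (\<integral>\<^sup>+ z. ennreal (L0\<^sup>2) \<partial>(unif_ball :: 'a measure))"
  proof (rule nn_integral_mono_AE, use slice in eventually_elim)
    case (elim z)
    have "(\<integral>\<^sup>+ s. ennreal ((norm (\<gamma>' (z, s)))\<^sup>2) \<partial>law_xi) = (\<integral>\<^sup>+ \<omega>. ennreal ((norm (\<gamma> (\<xi> \<omega>, z)))\<^sup>2) \<partial>M)"
      unfolding law_xi_def \<gamma>'_def by (subst nn_integral_distr) auto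
    then show ?case using moment elim by simp
  qed
  also have "\<dots> = ennreal (L0\<^sup>2)" using B.emeasure_space_1 by simp
  finally show sq: "(\<integral>\<^sup>+ \<omega>. ennreal ((norm (\<gamma> (\<xi> \<omega>, v \<omega>)))\<^sup>2) \<partial>M) \<le> ennreal (L0\<^sup>2)" .
  have "integrable M (\<lambda>\<omega>. \<gamma>' (v \<omega>, \<xi> \<omega>))"
    using first_moment_le_of_second_moment_le(3)[OF _ _ sq] L0 by (simp add: \<gamma>'_def)
  then have int: "integrable (unif_ball \<Otimes>\<^sub>M law_xi) \<gamma>'"
    using integral_joint_law(2)[OF \<gamma>'m] by (simp add: joint_law_def)
  define G where "G z = (\<integral>\<omega>. \<gamma> (\<xi> \<omega>, z) \<partial>M)" for z
  have G_eq: "(\<lambda>z. \<integral>s. \<gamma>' (z, s) \<partial>law_xi) = G"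
    unfolding G_def \<gamma>'_def by (auto intro!: ext integral_law_xi(1))
  have intG: "integrable unif_ball G"
    using integrable_fst'[OF int] unfolding G_eq .
  have "(\<integral>\<omega>. \<gamma> (\<xi> \<omega>, v \<omega>) \<partial>M) = (\<integral>q. \<gamma>' q \<partial>joint_law)"
    by (subst integral_joint_law(1)) (auto simp: \<gamma>'_def)
  also have "\<dots> = (\<integral>z. G z \<partial>unif_ball)"
    unfolding joint_law_def integral_fst'[OF int, symmetric] G_eq ..
  finally have mean: "(\<integral>\<omega>. \<gamma> (\<xi> \<omega>, v \<omega>) \<partial>M) = (\<integral>z. G z \<partial>unif_ball)" .
  have sub: "AE z in unif_ball. F (x + \<mu> *\<^sub>R z) + G z \<bullet> w \<le> F (x + w + \<mu> *\<^sub>R z)"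
    using slice
  proof eventually_elim
    case (elim z)
    then have z: "norm z < 1" by blast
    note pz = inU[OF z]
    have intz: "integrable M (\<lambda>\<omega>. \<gamma> (\<xi> \<omega>, z))"
      using first_moment_le_of_second_moment_le(3)[OF _ _ moment[OF z conjunct2[OF elim]]] L0 by simp
    have le: "mean_H (p z) + G z \<bullet> (q - p z) \<le> mean_H q" if "q \<in> D \<inter> U" for q
    proof -
      have "mean_H (p z) + G z \<bullet> (q - p z) = (\<integral>\<omega>. H_real (p z) (\<xi> \<omega>) + \<gamma> (\<xi> \<omega>, z) \<bullet> (q - p z) \<partial>M)"
        using H_real_integrable[OF pz] intz by (simp add: mean_H_def G_def)
      also have "\<dots> \<le> mean_H q"
        unfolding mean_H_def
      proof (rule integral_mono_AE)
        show "integrable M (\<lambda>\<omega>. H_real (p z) (\<xi> \<omega>) + \<gamma> (\<xi> \<omega>, z) \<bullet> (q - p z))"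
          using H_real_integrable[OF pz] intz by simp
        show "integrable M (\<lambda>\<omega>. H_real q (\<xi> \<omega>))" using that by (intro H_real_integrable) auto
        show "AE \<omega> in M. H_real (p z) (\<xi> \<omega>) + \<gamma> (\<xi> \<omega>, z) \<bullet> (q - p z) \<le> H_real q (\<xi> \<omega>)"
          using conjunct2[OF elim] by eventually_elim (use that in blast)
      qed
      finally show ?thesis .
    qed
    have "mean_H (p z) + G z \<bullet> (u - p z) \<le> mean_H u" if "u \<in> U" for u
    proof (rule le_on_open_if_le_on_dense[OF open_U D(2) _ _ le that])
      show "continuous_on U mean_H" using mean_H_lipschitz by (rule lipschitz_on_continuous_on)
    qed (auto intro!: continuous_intros)
    moreover have "convex (ereal_epigraph (\<lambda>y. ereal (F y)))"
    proof -
      have "ereal_epigraph (\<lambda>y. ereal (F y)) = epigraph UNIV F"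
        by (auto simp: ereal_epigraph_def epigraph_def)
      then show ?thesis using convex_epigraphI[OF F(1)] by simp
    qed
    ultimately have "G z \<in> subdifferential (\<lambda>y. ereal (F y)) (p z)"
      using open_U pz F(3)
      by (intro local_subgradient_imp_subgradient[of _ U _ "F (p z)"]) auto
    then have "ereal (F (p z)) + ereal (G z \<bullet> ((p z + w) - p z)) \<le> ereal (F (p z + w))"
      unfolding subdifferential_def by blast
    then show ?case by (simp add: p_def ac_simps)
  qed
  have "ball_average F \<mu> x + (\<integral>z. G z \<partial>unif_ball) \<bullet> w = (\<integral>z. F (x + \<mu> *\<^sub>R z) + G z \<bullet> w \<partial>unif_ball)"
    unfolding ball_average_def using intG lipschitz_integrable_unif_ball[OF F(2)] by simp
  also have "\<dots> \<le> ball_average F \<mu> (x + w)"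
    unfolding ball_average_def
    using sub intG lipschitz_integrable_unif_ball[OF F(2)]
    by (intro integral_mono_AE Bochner_Integration.integrable_add) auto
  finally show "ball_average F \<mu> x + (\<integral>\<omega>. \<gamma> (\<xi> \<omega>, v \<omega>) \<partial>M) \<bullet> w \<le> ball_average F \<mu> (x + w)"
    unfolding mean .
qed

section \<open>The smoothing theorem\<close>

text \<open>
  For \<open>\<mu> = mubar\<close> and \<open>x\<close> on the boundary of \<open>X\<close>, the perturbed points fill a ball that touches the boundary of
  \<open>U\<close>, so the average is not defined around \<open>x\<close>. With the extension it is defined everywhere, and derivatives
  relative to \<open>X\<close> come from derivatives in the whole space.
\<close>

lemma mean_H_extension:
  obtains F where "convex_on UNIV F" "L0-lipschitz_on UNIV F" "\<And>u. u \<in> U \<Longrightarrow> F u = mean_H u"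
  using convex_lipschitz_extension[OF mean_H_convex mean_H_lipschitz] X_nonempty X_subset_U by blast

lemma smoothed_eq_ball_average:
  assumes x: "x \<in> X" and \<mu>: "\<bar>\<mu>\<bar> \<le> mubar" and F: "L0-lipschitz_on UNIV F" "\<And>u. u \<in> U \<Longrightarrow> F u = mean_H u"
  shows "smoothed M \<xi> v H x \<mu> = ereal (ball_average F \<mu> x)"
proof -
  have "(\<integral>z. mean_H (x + \<mu> *\<^sub>R z) \<partial>unif_ball) = ball_average F \<mu> x"
    unfolding ball_average_def
  proof (rule integral_cong_AE)
    have c: "continuous_on UNIV (\<lambda>z. F (x + \<mu> *\<^sub>R z))"
      by (rule continuous_on_compose2[OF lipschitz_on_continuous_on[OF F(1)]]) (auto intro!: continuous_intros)
    show "(\<lambda>z. F (x + \<mu> *\<^sub>R z)) \<in> borel_measurable unif_ball"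
      using borel_measurable_continuous_onI[OF c] by simp
    show "(\<lambda>z. mean_H (x + \<mu> *\<^sub>R z)) \<in> borel_measurable unif_ball"
      unfolding mean_H_def by measurable
    show "AE z in unif_ball. mean_H (x + \<mu> *\<^sub>R z) = F (x + \<mu> *\<^sub>R z)"
      using AE_unif_ball by eventually_elim (simp add: F(2) perturbed_in_U[OF x \<mu>])
  qed
  then show ?thesis using smoothed_eq_average[OF x \<mu>] by simp
qed

text \<open>
  The gradient field is that of the ball average of one fixed extension. Relative to a set \<open>X\<close> with empty interior
  gradients are not unique, but this field serves every selection at once, because the mean of each
  selection is a subgradient in the whole space.
\<close>

lemma smoothing_and_unbiasedness:
  assumes f: "gradient_on X f gradf"
  shows "(\<forall>x\<in>X. \<forall>\<mu>\<in>{0<..mubar}. \<bar>smoothed M \<xi> v H x \<mu>\<bar> \<noteq> \<infinity>) \<and>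
    (\<exists>gradh :: 'a \<Rightarrow> real \<Rightarrow> 'a.
       smoothing_function X mubar h (\<lambda>x \<mu>. real_of_ereal (smoothed M \<xi> v H x \<mu>)) gradh
         ((L0\<^sup>2 + 1) / 2) 0 (L0 * sqrt (real DIM('a))) \<and>
       (\<forall>g. subgradient_selection M \<xi> v H X mubar g \<longrightarrow>
          unbiased_bounded_variance M (\<lambda>\<omega>. (\<xi> \<omega>, v \<omega>)) X mubar
            (\<lambda>x \<mu>. f x + real_of_ereal (smoothed M \<xi> v H x \<mu>))
            (\<lambda>x \<mu>. gradf x + gradh x \<mu>)
            (\<lambda>x \<mu> \<zeta>. gradf x + g x \<mu> \<zeta>) (L0\<^sup>2)))"
proof -
  obtain F where F: "convex_on UNIV F" "L0-lipschitz_on UNIV F" "\<And>u. u \<in> U \<Longrightarrow> F u = mean_H u"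
    using mean_H_extension by blast
  have "\<exists>G. (\<forall>x. (ball_average F \<mu> has_derivative (\<lambda>w. G x \<bullet> w)) (at x)) \<and>
      (L0 * sqrt DIM('a) / \<mu>)-lipschitz_on UNIV G" if "\<mu> > 0" for \<mu>
    using ball_average_gradient[OF F(1,2) L0 that] by blast
  then obtain G where G: "\<And>\<mu> x. \<mu> > 0 \<Longrightarrow> (ball_average F \<mu> has_derivative (\<lambda>w. G \<mu> x \<bullet> w)) (at x)"
    "\<And>\<mu>. \<mu> > 0 \<Longrightarrow> (L0 * sqrt DIM('a) / \<mu>)-lipschitz_on UNIV (G \<mu>)"
    by metis
  define s where "s x \<mu> = real_of_ereal (smoothed M \<xi> v H x \<mu>)" for x \<mu>
  have sm: "smoothed M \<xi> v H x \<mu> = ereal (ball_average F \<mu> x)" if "x \<in> X" "\<mu> \<in> {0<..mubar}" for x \<mu>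
    using that by (intro smoothed_eq_ball_average F) auto
  then have s: "s x \<mu> = ball_average F \<mu> x" if "x \<in> X" "\<mu> \<in> {0<..mubar}" for x \<mu>
    using that by (simp add: s_def)
  have hF: "h x = F x" if "x \<in> X" for x
    using that X_subset_U F(3) expectation_on_X(2) by (metis subsetD)
  have grad: "gradient_on X (\<lambda>x. s x \<mu>) (G \<mu>)" if \<mu>: "\<mu> \<in> {0<..mubar}" for \<mu>
    unfolding gradient_on_def
  proof
    fix x assume x: "x \<in> X"
    have "(ball_average F \<mu> has_derivative (\<lambda>w. G \<mu> x \<bullet> w)) (at x within X)"
      using \<mu> by (simp add: has_derivative_at_withinI[OF G(1)])
    then show "((\<lambda>x. s x \<mu>) has_derivative (\<lambda>w. G \<mu> x \<bullet> w)) (at x within X)"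
      by (rule has_derivative_transform[OF x s[OF _ \<mu>], rotated])
  qed
  have lip: "(L0 * sqrt DIM('a) / \<mu>)-lipschitz_on X (G \<mu>)" if "\<mu> \<in> {0<..mubar}" for \<mu>
    using that by (intro lipschitz_on_subset[OF G(2) subset_UNIV]) simp
  have L0_le: "L0 \<le> (L0\<^sup>2 + 1) / 2"
    using zero_le_power2[of "L0 - 1"] by (simp add: power2_eq_square algebra_simps)
  have convex_X: "convex_on X c'" if "convex_on UNIV c" "\<And>x. x \<in> X \<Longrightarrow> c' x = c x" for c c' :: "'a \<Rightarrow> real"
  proof (rule convex_onI[OF _ X_convex])
    fix t x y assume t: "0 < t" "t < (1::real)" and xy: "x \<in> X" "y \<in> X"
    have "(1 - t) *\<^sub>R x + t *\<^sub>R y \<in> X" using t xy by (intro convexD[OF X_convex]) auto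
    then show "c' ((1 - t) *\<^sub>R x + t *\<^sub>R y) \<le> (1 - t) * c' x + t * c' y"
      using convex_onD[OF that(1), of t x y] t xy by (simp add: that(2))
  qed
  have "smoothing_function X mubar h s (\<lambda>x \<mu>. G \<mu> x) ((L0\<^sup>2 + 1) / 2) 0 (L0 * sqrt (real DIM('a)))"
    unfolding smoothing_function_def
  proof (intro conjI ballI)
    show "convex_on X h"
      by (rule convex_X[OF F(1) hF])
    show "0 < (L0\<^sup>2 + 1) / 2" by (simp add: add_nonneg_pos)
    show "0 < L0 * sqrt (real DIM('a))" using L0 by simp
    fix \<mu> assume \<mu>: "\<mu> \<in> {0<..mubar}"
    show "gradient_on X (\<lambda>x. s x \<mu>) (G \<mu>)" by (rule grad[OF \<mu>])
    show "continuous_on X (G \<mu>)" using lip[OF \<mu>] by (rule lipschitz_on_continuous_on)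
    show "(0 + L0 * sqrt (real DIM('a)) / \<mu>)-lipschitz_on X (G \<mu>)" using lip[OF \<mu>] by simp
    show "convex_on X (\<lambda>x. s x \<mu>)"
      by (rule convex_X[OF ball_average_convex[OF F(1,2)] s[OF _ \<mu>]])
  next
    fix x \<mu>1 \<mu>2 assume x: "x \<in> X" and \<mu>: "\<mu>1 \<in> {0<..mubar}" "\<mu>2 \<in> {0<..mubar}"
    have "\<bar>s x \<mu>2 - s x \<mu>1\<bar> \<le> L0 * \<bar>\<mu>2 - \<mu>1\<bar>"
      using ball_average_lipschitz[OF F(2), of \<mu>2 x \<mu>1 x] by (simp add: s[OF x \<mu>(1)] s[OF x \<mu>(2)])
    also have "\<dots> \<le> (L0\<^sup>2 + 1) / 2 * \<bar>\<mu>1 - \<mu>2\<bar>"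
      using L0_le by (subst abs_minus_commute) (intro mult_right_mono, auto)
    finally show "\<bar>s x \<mu>2 - s x \<mu>1\<bar> \<le> (L0\<^sup>2 + 1) / 2 * \<bar>\<mu>1 - \<mu>2\<bar>" .
  next
    fix x assume x: "x \<in> X"
    let ?A = "at (x, 0) within X \<times> {0<..mubar}"
    have "((\<lambda>p. L0 * (norm (fst p - x) + \<bar>snd p - 0\<bar>)) \<longlongrightarrow> L0 * (norm (fst (x, 0::real) - x) + \<bar>snd (x, 0::real) - 0\<bar>)) ?A"
      by (intro tendsto_intros)
    then have "((\<lambda>p. L0 * (norm (fst p - x) + \<bar>snd p - 0\<bar>)) \<longlongrightarrow> 0) ?A" by simp
    moreover have "eventually (\<lambda>p. norm ((case p of (z, \<mu>) \<Rightarrow> s z \<mu>) - h x) \<le> L0 * (norm (fst p - x) + \<bar>snd p - 0\<bar>)) ?A"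
      unfolding eventually_at_filter
    proof (intro always_eventually allI impI)
      fix p :: "'a \<times> real" assume "p \<in> X \<times> {0<..mubar}"
      then have p: "fst p \<in> X" "snd p \<in> {0<..mubar}" by auto
      show "norm ((case p of (z, \<mu>) \<Rightarrow> s z \<mu>) - h x) \<le> L0 * (norm (fst p - x) + \<bar>snd p - 0\<bar>)"
        using ball_average_lipschitz[OF F(2), of "snd p" "fst p" 0 x]
        unfolding split_beta s[OF p] hF[OF x] by simp
    qed
    ultimately have "((\<lambda>p. (case p of (z, \<mu>) \<Rightarrow> s z \<mu>) - h x) \<longlongrightarrow> 0) ?A"
      by (rule Lim_null_comparison[rotated])
    then show "((\<lambda>(z, \<mu>). s z \<mu>) \<longlongrightarrow> h x) ?A" by (simp only: LIM_zero_iff)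
  qed
  moreover have "unbiased_bounded_variance M (\<lambda>\<omega>. (\<xi> \<omega>, v \<omega>)) X mubar (\<lambda>x \<mu>. f x + s x \<mu>)
      (\<lambda>x \<mu>. gradf x + G \<mu> x) (\<lambda>x \<mu> \<zeta>. gradf x + g x \<mu> \<zeta>) (L0\<^sup>2)"
    if g: "subgradient_selection M \<xi> v H X mubar g" for g
    unfolding unbiased_bounded_variance_def
  proof (intro conjI ballI)
    fix \<mu> assume \<mu>: "\<mu> \<in> {0<..mubar}"
    show "gradient_on X (\<lambda>x. f x + s x \<mu>) (\<lambda>x. gradf x + G \<mu> x)"
      using f grad[OF \<mu>] unfolding gradient_on_def inner_add_left
      by (intro ballI, rule_tac has_derivative_add) simp_all
  next
    fix x \<mu> assume x: "x \<in> X" and \<mu>: "\<mu> \<in> {0<..mubar}"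
    let ?g = "\<lambda>\<omega>. g x \<mu> (\<xi> \<omega>, v \<omega>)"
    have \<mu>': "\<bar>\<mu>\<bar> \<le> mubar" using \<mu> by auto
    have gm [measurable]: "g x \<mu> \<in> borel_measurable (borel \<Otimes>\<^sub>M borel)"
      and g_sub: "AE \<omega> in M. ?g \<omega> \<in> subdifferential (\<lambda>y. H y (\<xi> \<omega>)) (x + \<mu> *\<^sub>R v \<omega>)"
      using g x \<mu> by (auto simp: subgradient_selection_def)
    note mom = selection_moments[OF x \<mu>' gm g_sub F]
    have "?g \<in> borel_measurable M" by measurable
    note int = first_moment_le_of_second_moment_le[OF this less_imp_le[OF L0] mom(1)]
    \<comment> \<open>the derivative in the whole space, not relative to \<open>X\<close>, determines the subgradient uniquely\<close>
    have mean: "(\<integral>\<omega>. ?g \<omega> \<partial>M) = G \<mu> x"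
    proof (rule derivative_eq_subgradient)
      show "(ball_average F \<mu> has_derivative (\<lambda>w. G \<mu> x \<bullet> w)) (at x)" using \<mu> by (intro G(1)) simp
      show "ball_average F \<mu> x + (\<integral>\<omega>. ?g \<omega> \<partial>M) \<bullet> (y - x) \<le> ball_average F \<mu> y" for y
        using mom(2)[of "y - x"] by simp
    qed
    show "integrable M (\<lambda>\<omega>. gradf x + ?g \<omega>)" using int(3) by simp
    show "(\<integral>\<omega>. gradf x + ?g \<omega> \<partial>M) = gradf x + G \<mu> x"
      using int(3) mean prob_space by simp
    show "integrable M (\<lambda>\<omega>. (norm (gradf x + ?g \<omega> - (gradf x + G \<mu> x)))\<^sup>2)"
      using variance_le_second_moment(1)[OF int(3,1)] by (simp add: mean)
    show "(\<integral>\<omega>. (norm (gradf x + ?g \<omega> - (gradf x + G \<mu> x)))\<^sup>2 \<partial>M) \<le> L0\<^sup>2"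
      using variance_le_second_moment(2)[OF int(3,1)] int(2) by (simp add: mean)
  qed
  ultimately show ?thesis
    unfolding s_def using sm by (intro conjI ballI exI[of _ "\<lambda>x \<mu>. G \<mu> x"]) auto
qed

end

theorem lemma2:
  fixes M :: "'w measure"
    and \<xi> :: "'w \<Rightarrow> 'b::euclidean_space"
    and v :: "'w \<Rightarrow> 'a::euclidean_space"
    and H :: "'a \<Rightarrow> 'b \<Rightarrow> ereal"
    and X :: "'a set"
    and f h :: "'a \<Rightarrow> real"
    and gradf :: "'a \<Rightarrow> 'a"
    and mubar L0 :: real
  assumes "prob_space M"
    and "closed X" and "convex X"
    and "\<xi> \<in> borel_measurable M"
    and "distributed M lborel v (\<lambda>y. indicator (cball 0 1) y / measure lborel (cball (0::'a) 1))"
    and "indep_rvs M \<xi> v"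
    and "(\<lambda>(x, s). H x s) \<in> borel_measurable (borel \<Otimes>\<^sub>M borel)"
    and "\<And>s. s \<in> rv_support M \<xi> \<Longrightarrow> closed_proper_convex (\<lambda>x. H x s)"
    and "\<And>x. x \<in> X \<Longrightarrow> ereal (h x) = ext_expectation M (\<lambda>\<omega>. H x (\<xi> \<omega>))"
    and "continuous_on X h"
    and "convex_on X f" and "gradient_on X f gradf" and "\<exists>L. L-lipschitz_on X gradf"
    and "0 < mubar" and "0 < L0"
    and "\<And>\<mu> x. \<mu> \<in> {0<..mubar} \<Longrightarrow> x \<in> interior (X + cball 0 \<mu>) \<Longrightarrow>
           ext_expectation M (\<lambda>\<omega>. (set_norm (subdifferential (\<lambda>y. H y (\<xi> \<omega>)) x))\<^sup>2) \<le> ereal (L0\<^sup>2)"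
  shows "(\<forall>x\<in>X. \<forall>\<mu>\<in>{0<..mubar}. \<bar>smoothed M \<xi> v H x \<mu>\<bar> \<noteq> \<infinity>) \<and>
    (\<exists>gradh :: 'a \<Rightarrow> real \<Rightarrow> 'a.
       smoothing_function X mubar h (\<lambda>x \<mu>. real_of_ereal (smoothed M \<xi> v H x \<mu>)) gradh
         ((L0\<^sup>2 + 1) / 2) 0 (L0 * sqrt (real DIM('a))) \<and>
       (\<forall>g. subgradient_selection M \<xi> v H X mubar g \<longrightarrow>
          unbiased_bounded_variance M (\<lambda>\<omega>. (\<xi> \<omega>, v \<omega>)) X mubar
            (\<lambda>x \<mu>. f x + real_of_ereal (smoothed M \<xi> v H x \<mu>))
            (\<lambda>x \<mu>. gradf x + gradh x \<mu>)
            (\<lambda>x \<mu> \<zeta>. gradf x + g x \<mu> \<zeta>) (L0\<^sup>2)))"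
proof (cases "X = {}")
  case True
  have "smoothing_function X mubar h c (\<lambda>x \<mu>. 0) ((L0\<^sup>2 + 1) / 2) 0 (L0 * sqrt (real DIM('a)))" for c
    using True \<open>0 < L0\<close>
    by (auto simp: smoothing_function_def convex_on_def gradient_on_def lipschitz_on_def add_nonneg_pos)
  moreover have "unbiased_bounded_variance M \<zeta> X mubar psi gpsi G (L0\<^sup>2)" for \<zeta> :: "'w \<Rightarrow> 'b \<times> 'a" and psi gpsi G
    using True by (auto simp: unbiased_bounded_variance_def gradient_on_def)
  ultimately show ?thesis using True by blast
next
  case False
  interpret prob_space M by fact
  interpret randomized_smoothing M \<xi> v H X h mubar L0
  proof
    show "v \<in> borel_measurable M" "distr M borel v = unif_ball"
      using assms(5) by (auto simp: distributed_def unif_ball_def cong: distr_cong)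
    show "ext_expectation M (\<lambda>\<omega>. (set_norm (subdifferential (\<lambda>y. H y (\<xi> \<omega>)) x))\<^sup>2) \<le> ereal (L0\<^sup>2)"
      if "x \<in> interior (X + cball 0 mubar)" for x
      using assms(16)[of mubar x] that \<open>0 < mubar\<close> by simp
  qed (use assms False in auto)
  show ?thesis by (rule smoothing_and_unbiasedness[OF assms(12)])
qed

end
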